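(* Let $G$ be an $(s,k)$-edge-connected graph such that $k\geq 2$ and $\deg(s)\geq 4$. (1) Any two maximal independent sets of $L(G,s,k)$ intersect in at most one vertex. (2) If the union of two intersecting maximal independent sets of $L(G,s,k)$ equals $V(L(G,s,k))$, then $\deg(s)$ is odd and both sets have size $(\deg(s)+1)/2$. (3) If $\deg(s)>4$ and there exist two intersecting maximal independent sets of $L(G,s,k)$ of size $\lceil \deg(s)/2\rceil$, then $L(G,s,k)$ is the disjoint union of an isolated vertex and a balanced complete bipartite graph; in particular these two sets are the only maximal independent sets of $L(G,s,k)$, and the isolated vertex is their intersection. (4) If $k$ is even and either $\deg(s)$ is even or at most one independent set of $L(G,s,k)$ has size $\lceil\deg(s)/2\rceil$, then the maximal independent sets of $L(G,s,k)$ are pairwise disjoint (i.e. $L(G,s,k)$ is complete multipartite). Moreover, if $L(G,s,k)$ is complete multipartite, then it is not a star.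
   Context: All graphs are finite loopless multigraphs. A graph $G$ is $(s,k)$-edge-connected if $G$ has at least three vertices, $s$ is a vertex of $G$, $k$ is a positive integer, and any two vertices of $G$ both different from $s$ are joined by $k$ pairwise edge-disjoint paths in $G$ (these paths may pass through $s$). Lifting two edges $sv,sw$ incident with $s$ means deleting them and adding a new edge $vw$ if $v\neq w$, and only deleting them if $v=w$; call the result $G_{v,w}$. Edges $sv,sw$ form a $k$-liftable pair if $G_{v,w}$ is $(s,k)$-edge-connected. The $k$-lifting graph $L(G,s,k)$ has as vertices the edges of $G$ incident with $s$, two being adjacent iff they form a $k$-liftable pair. *)

theory Defs
  imports Complex_Main "HOL-Library.Disjoint_Sets"
begin

text \<open>Edges are named objects, so that parallel edges are distinguished; two edges are parallel
  when they have the same set of ends.\<close>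

record ('v, 'e) multigraph =
  verts :: "'v set"
  edges :: "'e set"
  ends :: "'e \<Rightarrow> 'v set"

definition finite_loopless_multigraph :: "('v, 'e) multigraph \<Rightarrow> bool" where
  "finite_loopless_multigraph G \<longleftrightarrow>
     finite (verts G) \<and> finite (edges G) \<and>
     (\<forall>e \<in> edges G. ends G e \<subseteq> verts G \<and> card (ends G e) = 2)"

definition incident_edges :: "('v, 'e) multigraph \<Rightarrow> 'v \<Rightarrow> 'e set" where
  "incident_edges G v = {e \<in> edges G. v \<in> ends G e}"

definition degree :: "('v, 'e) multigraph \<Rightarrow> 'v \<Rightarrow> nat" where
  "degree G v = card (incident_edges G v)"

fun is_walk :: "('v, 'e) multigraph \<Rightarrow> 'v list \<Rightarrow> 'e list \<Rightarrow> bool" where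
  "is_walk G [v] [] \<longleftrightarrow> v \<in> verts G"
| "is_walk G (u # v # vs) (e # es) \<longleftrightarrow>
     u \<in> verts G \<and> e \<in> edges G \<and> ends G e = {u, v} \<and> is_walk G (v # vs) es"
| "is_walk G _ _ \<longleftrightarrow> False"

definition is_path :: "('v, 'e) multigraph \<Rightarrow> 'v \<Rightarrow> 'v list \<Rightarrow> 'e list \<Rightarrow> 'v \<Rightarrow> bool" where
  "is_path G u vs es v \<longleftrightarrow> is_walk G vs es \<and> distinct vs \<and> hd vs = u \<and> last vs = v"

definition joined_by_edge_disjoint_paths :: "('v, 'e) multigraph \<Rightarrow> nat \<Rightarrow> 'v \<Rightarrow> 'v \<Rightarrow> bool" where
  "joined_by_edge_disjoint_paths G k u v \<longleftrightarrow>
     (\<exists>(vs :: nat \<Rightarrow> 'v list) (es :: nat \<Rightarrow> 'e list).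
        (\<forall>i < k. is_path G u (vs i) (es i) v) \<and>
        (\<forall>i < k. \<forall>j < k. i \<noteq> j \<longrightarrow> set (es i) \<inter> set (es j) = {}))"

definition sk_edge_connected :: "('v, 'e) multigraph \<Rightarrow> 'v \<Rightarrow> nat \<Rightarrow> bool" where
  "sk_edge_connected G s k \<longleftrightarrow>
     finite_loopless_multigraph G \<and> card (verts G) \<ge> 3 \<and> s \<in> verts G \<and> k > 0 \<and>
     (\<forall>u \<in> verts G - {s}. \<forall>v \<in> verts G - {s}. u \<noteq> v \<longrightarrow> joined_by_edge_disjoint_paths G k u v)"

definition other_end :: "('v, 'e) multigraph \<Rightarrow> 'v \<Rightarrow> 'e \<Rightarrow> 'v" where
  "other_end G s e = the_elem (ends G e - {s})"

text \<open>When the other ends \<open>v\<close>, \<open>w\<close> of \<open>e\<close>, \<open>f\<close> differ, the new edge \<open>vw\<close> reuses the name \<open>e\<close>, which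
  has just been freed. Exchanging \<open>e\<close> and \<open>f\<close> only renames an edge of the result.\<close>

definition lift_pair :: "('v, 'e) multigraph \<Rightarrow> 'v \<Rightarrow> 'e \<Rightarrow> 'e \<Rightarrow> ('v, 'e) multigraph" where
  "lift_pair G s e f =
     (let v = other_end G s e; w = other_end G s f
      in if v = w then G\<lparr>edges := edges G - {e, f}\<rparr>
         else G\<lparr>edges := insert e (edges G - {e, f}), ends := (ends G)(e := {v, w})\<rparr>)"

definition liftable_pair :: "('v, 'e) multigraph \<Rightarrow> 'v \<Rightarrow> nat \<Rightarrow> 'e \<Rightarrow> 'e \<Rightarrow> bool" where
  "liftable_pair G s k e f \<longleftrightarrow>
     e \<in> incident_edges G s \<and> f \<in> incident_edges G s \<and> e \<noteq> f \<and>
     sk_edge_connected (lift_pair G s e f) s k"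

text \<open>A simple graph is a pair of a vertex set and a set of two-element sets of vertices.\<close>

type_synonym 'a sgraph = "'a set \<times> 'a set set"

definition lifting_graph :: "('v, 'e) multigraph \<Rightarrow> 'v \<Rightarrow> nat \<Rightarrow> 'e sgraph" where
  "lifting_graph G s k = (incident_edges G s, {{e, f} | e f. liftable_pair G s k e f})"

definition independent_set :: "'a sgraph \<Rightarrow> 'a set \<Rightarrow> bool" where
  "independent_set L I \<longleftrightarrow> I \<subseteq> fst L \<and> (\<forall>x \<in> I. \<forall>y \<in> I. {x, y} \<notin> snd L)"

definition maximal_independent_set :: "'a sgraph \<Rightarrow> 'a set \<Rightarrow> bool" where
  "maximal_independent_set L I \<longleftrightarrow>
     independent_set L I \<and> (\<forall>J. independent_set L J \<and> I \<subseteq> J \<longrightarrow> J = I)"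

definition complete_multipartite :: "'a sgraph \<Rightarrow> bool" where
  "complete_multipartite L \<longleftrightarrow>
     (\<exists>P. partition_on (fst L) P \<and>
          snd L = {{x, y} | x y. \<exists>p \<in> P. \<exists>q \<in> P. p \<noteq> q \<and> x \<in> p \<and> y \<in> q})"

definition star :: "'a sgraph \<Rightarrow> bool" where
  "star L \<longleftrightarrow> (\<exists>c \<in> fst L. snd L = {{c, x} | x. x \<in> fst L - {c}})"

definition balanced_complete_bipartite :: "'a sgraph \<Rightarrow> bool" where
  "balanced_complete_bipartite L \<longleftrightarrow>
     (\<exists>A B. finite A \<and> finite B \<and> A \<inter> B = {} \<and> card A = card B \<and>
            fst L = A \<union> B \<and> snd L = {{a, b} | a b. a \<in> A \<and> b \<in> B})"

definition isolated_vertex_plus :: "'a sgraph \<Rightarrow> 'a \<Rightarrow> 'a sgraph \<Rightarrow> bool" where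
  "isolated_vertex_plus L z H \<longleftrightarrow> z \<notin> fst H \<and> L = (insert z (fst H), snd H)"

end

theory Submission
  imports Defs
begin

text \<open>By Menger's theorem two edges at \<open>s\<close> fail to be liftable exactly when both other ends lie in
  a dangerous set: a nonempty proper subset \<open>X\<close> of \<open>U = V - {s}\<close> with \<open>d(X) \<le> k + 1\<close>. Comparing
  \<open>X\<close> with \<open>U - X\<close> shows that \<open>X\<close> receives at most \<open>(deg s + 1) / 2\<close> edges from \<open>s\<close>. If dangerous
  sets \<open>X\<close>, \<open>Y\<close> cross and receive a common edge from \<open>s\<close>, posimodularity of \<open>d\<close> is tight: the
  common edge is unique, \<open>d(X) = d(Y) = k + 1\<close> and \<open>d(X - Y) = d(Y - X) = k\<close>. If \<open>X \<union> Y = U\<close>, each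
  of them then receives exactly \<open>(deg s + 1) / 2\<close> edges; otherwise \<open>d(X \<union> Y) \<le> k + 2\<close>, and as
  \<open>d(X \<inter> Y)\<close> is odd, \<open>X \<union> Y\<close> is dangerous when \<open>k\<close> is even.

  The crucial point is that three pairwise non-liftable edges enter a common dangerous set.
  Otherwise there are dangerous sets \<open>X\<close>, \<open>Y\<close>, \<open>Z\<close>, each entered by exactly two of the edges, with
  no dangerous pairwise union. Then the pairwise intersections have cuts of size \<open>k\<close>, \<open>X \<inter> Y \<inter> Z\<close>
  is empty, none of the three sets is covered by the other two, and counting the three edges twice
  gives \<open>d(X) + d(Y) + d(Z) \<ge> d(X - Y - Z) + d(Y - X - Z) + d(Z - X - Y) + 6 \<ge> 3 k + 6\<close>, a
  contradiction. Since the dangerous sets entered by two given edges form a chain, a maximal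
  independent set with at least two elements consists of the edges from \<open>s\<close> into one dangerous
  set, which any two of its elements determine.\<close>

section \<open>Maximal independent sets of simple graphs\<close>

lemma maximal_independent_setD:
  assumes "maximal_independent_set L I"
  shows "independent_set L I" "I \<subseteq> fst L" "\<And>J. independent_set L J \<Longrightarrow> I \<subseteq> J \<Longrightarrow> J = I"
  using assms by (auto simp: maximal_independent_set_def independent_set_def)

locale finite_sgraph =
  fixes L :: "'a sgraph"
  assumes finite_vertices: "finite (fst L)"
    and edge_ends: "p \<in> snd L \<Longrightarrow> \<exists>x \<in> fst L. \<exists>y \<in> fst L. x \<noteq> y \<and> p = {x, y}"
begin

lemma finite_independent_set: "independent_set L I \<Longrightarrow> finite I"
  using finite_vertices finite_subset by (auto simp: independent_set_def)

lemma finite_maximal: "maximal_independent_set L I \<Longrightarrow> finite I"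
  by (simp add: finite_independent_set maximal_independent_setD)

lemma independent_set_extends_to_maximal:
  assumes "independent_set L I"
  obtains J where "maximal_independent_set L J" "I \<subseteq> J"
proof -
  have "finite {J. independent_set L J}"
    by (rule finite_subset[of _ "Pow (fst L)"]) (auto simp: independent_set_def finite_vertices)
  then obtain J where "independent_set L J" "I \<subseteq> J" "\<And>K. independent_set L K \<Longrightarrow> J \<subseteq> K \<Longrightarrow> J = K"
    using finite_has_maximal2[of "{J. independent_set L J}" I] assms by auto
  then have "maximal_independent_set L J" by (auto simp: maximal_independent_set_def)
  then show ?thesis using that \<open>I \<subseteq> J\<close> by blast
qed

lemma not_self_adjacent: "{x} \<notin> snd L"
  using edge_ends by fastforce

lemma independent_pair_iff:
  "independent_set L {x, y} \<longleftrightarrow> x \<in> fst L \<and> y \<in> fst L \<and> {x, y} \<notin> snd L"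
  by (auto simp: independent_set_def not_self_adjacent insert_commute)

lemma nonadjacent_iff_common_maximal:
  assumes "x \<in> fst L" "y \<in> fst L"
  shows "{x, y} \<notin> snd L \<longleftrightarrow> (\<exists>I. maximal_independent_set L I \<and> x \<in> I \<and> y \<in> I)"
proof
  assume "{x, y} \<notin> snd L"
  then have "independent_set L {x, y}" using assms by (simp add: independent_pair_iff)
  then obtain I where "maximal_independent_set L I" "{x, y} \<subseteq> I"
    by (rule independent_set_extends_to_maximal)
  then show "\<exists>I. maximal_independent_set L I \<and> x \<in> I \<and> y \<in> I" by blast
qed (auto simp: maximal_independent_set_def independent_set_def)

lemma vertex_in_maximal: "x \<in> fst L \<Longrightarrow> \<exists>I. maximal_independent_set L I \<and> x \<in> I"
  using nonadjacent_iff_common_maximal[of x x] not_self_adjacent by simp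

lemma edge_set_eqI:
  assumes adjacent: "\<And>x y. x \<in> fst L \<Longrightarrow> y \<in> fst L \<Longrightarrow> {x, y} \<in> snd L \<longleftrightarrow> R x y \<or> R y x"
    and field: "\<And>x y. R x y \<Longrightarrow> x \<in> fst L \<and> y \<in> fst L"
  shows "snd L = {{x, y} | x y. R x y}"
proof (intro equalityI subsetI)
  fix p assume p: "p \<in> snd L"
  then obtain x y where "p = {x, y}" "x \<in> fst L" "y \<in> fst L" using edge_ends by blast
  then have "p = {x, y} \<and> R x y \<or> p = {y, x} \<and> R y x" using adjacent p by (auto simp: insert_commute)
  then show "p \<in> {{x, y} | x y. R x y}" by blast
next
  fix p assume "p \<in> {{x, y} | x y. R x y}"
  then show "p \<in> snd L" using adjacent field by blast
qed

lemma complete_multipartite_if_maximal_disjoint: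
  assumes nonempty: "fst L \<noteq> {}"
    and disjoint: "\<And>I J. maximal_independent_set L I \<Longrightarrow> maximal_independent_set L J \<Longrightarrow> I \<noteq> J \<Longrightarrow>
      I \<inter> J = {}"
  shows "complete_multipartite L"
proof -
  define P where "P = {I. maximal_independent_set L I}"
  have cover: "\<Union> P = fst L"
    unfolding P_def using vertex_in_maximal maximal_independent_setD(2) by blast
  have unique_part: "p = q" if "p \<in> P" "q \<in> P" "x \<in> p" "x \<in> q" for p q x
    using that disjoint by (auto simp: P_def)
  have "{} \<notin> P"
  proof
    assume "{} \<in> P"
    then have "I = {}" if "I \<in> P" for I
      using that maximal_independent_setD(1,3) by (fastforce simp: P_def)
    then show False using cover nonempty by blast
  qed
  with cover have "partition_on (fst L) P"
    using disjoint by (intro partition_onI) (auto simp: P_def disjnt_def)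
  moreover have "snd L = {{x, y} | x y. \<exists>p \<in> P. \<exists>q \<in> P. p \<noteq> q \<and> x \<in> p \<and> y \<in> q}"
  proof (rule edge_set_eqI)
    fix x y assume xy: "x \<in> fst L" "y \<in> fst L"
    then have "{x, y} \<notin> snd L \<longleftrightarrow> (\<exists>r \<in> P. x \<in> r \<and> y \<in> r)"
      using nonadjacent_iff_common_maximal by (auto simp: P_def)
    moreover obtain p q where "p \<in> P" "x \<in> p" "q \<in> P" "y \<in> q" using xy cover by blast
    ultimately show "{x, y} \<in> snd L \<longleftrightarrow>
        (\<exists>p \<in> P. \<exists>q \<in> P. p \<noteq> q \<and> x \<in> p \<and> y \<in> q) \<or> (\<exists>p \<in> P. \<exists>q \<in> P. p \<noteq> q \<and> y \<in> p \<and> x \<in> q)"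
      using unique_part by blast
  qed (use cover in blast)
  ultimately show ?thesis unfolding complete_multipartite_def by blast
qed

lemma star_has_large_independent_set:
  assumes "star L"
  obtains I where "independent_set L I" "card (fst L) = Suc (card I)"
proof -
  obtain c where "c \<in> fst L" and edges: "snd L = {{c, x} | x. x \<in> fst L - {c}}"
    using assms unfolding star_def by blast
  have "independent_set L (fst L - {c})"
    unfolding independent_set_def edges by (auto simp: doubleton_eq_iff)
  moreover have "card (fst L) = Suc (card (fst L - {c}))"
    using card_Suc_Diff1[OF finite_vertices \<open>c \<in> fst L\<close>] by simp
  ultimately show ?thesis by (rule that)
qed

end

locale almost_disjoint_sgraph = finite_sgraph +
  assumes card_maximal_Int_le_1: "maximal_independent_set L I \<Longrightarrow> maximal_independent_set L J \<Longrightarrow>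
    I \<noteq> J \<Longrightarrow> card (I \<inter> J) \<le> 1"
begin

lemma maximal_eq_if_share_two:
  assumes "maximal_independent_set L I" "maximal_independent_set L J"
    and "x \<in> I \<inter> J" "y \<in> I \<inter> J" "x \<noteq> y"
  shows "I = J"
proof (rule ccontr)
  assume "I \<noteq> J"
  then have "card (I \<inter> J) \<le> Suc 0" using card_maximal_Int_le_1 assms(1,2) by simp
  then show False using assms finite_maximal[of I] card_le_Suc0_iff_eq[of "I \<inter> J"] by blast
qed

context
  fixes I J
  assumes maximal: "maximal_independent_set L I" "maximal_independent_set L J"
    and distinct: "I \<noteq> J" and intersecting: "I \<inter> J \<noteq> {}"
begin

lemma maximal_Int_singleton: obtains z where "I \<inter> J = {z}"
  using maximal_eq_if_share_two[OF maximal] distinct intersecting by blast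

lemma card_maximal_Un: "card I + card J = Suc (card (I \<union> J))"
proof -
  obtain z where "I \<inter> J = {z}" by (rule maximal_Int_singleton)
  then show ?thesis using card_Un_Int[of I J] maximal finite_maximal by simp
qed

context
  assumes cover: "I \<union> J = fst L"
begin

lemma shared_vertex_isolated: "z \<in> I \<inter> J \<Longrightarrow> x \<in> fst L \<Longrightarrow> {z, x} \<notin> snd L"
  using nonadjacent_iff_common_maximal[of z x] maximal cover by blast

lemma shared_vertex_in_every_maximal:
  assumes "z \<in> I \<inter> J" "maximal_independent_set L K"
  shows "z \<in> K"
proof -
  note K = maximal_independent_setD[OF assms(2)]
  have "z \<in> fst L" using assms(1) cover by blast
  have "{z, x} \<notin> snd L" "{x, z} \<notin> snd L" if "x \<in> fst L" for x
    using shared_vertex_isolated[OF assms(1) that] by (simp_all add: insert_commute)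
  then have "independent_set L (insert z K)"
    using K(1) \<open>z \<in> fst L\<close> by (auto simp: independent_set_def not_self_adjacent)
  then show ?thesis using K(3) by blast
qed

lemma covering_pair_only_maximal: "{K. maximal_independent_set L K} = {I, J}"
proof (intro equalityI subsetI)
  fix K assume "K \<in> {K. maximal_independent_set L K}"
  then have K: "maximal_independent_set L K" by simp
  obtain z where z: "I \<inter> J = {z}" by (rule maximal_Int_singleton)
  have "z \<in> K" using shared_vertex_in_every_maximal z K by blast
  have "K \<noteq> {z}"
  proof
    assume "K = {z}"
    then have "K \<subseteq> I" "K \<subseteq> J" using z by auto
    then show False
      using maximal_independent_setD(3)[OF K] maximal_independent_setD(1) maximal distinct by metis
  qed
  then obtain x where "x \<in> K" "x \<noteq> z" using \<open>z \<in> K\<close> by blast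
  then have "x \<in> I \<or> x \<in> J" using cover maximal_independent_setD(2)[OF K] by blast
  then show "K \<in> {I, J}"
    using maximal_eq_if_share_two[OF K, of _ x z] maximal \<open>x \<in> K\<close> \<open>x \<noteq> z\<close> \<open>z \<in> K\<close> z by blast
qed (use maximal in auto)

lemma covering_pair_structure:
  assumes "card I = card J"
  shows "\<exists>z H. isolated_vertex_plus L z H \<and> balanced_complete_bipartite H \<and>
    {K. maximal_independent_set L K} = {I, J} \<and> I \<inter> J = {z}"
proof -
  obtain z where z: "I \<inter> J = {z}" by (rule maximal_Int_singleton)
  define A B where "A = I - {z}" and "B = J - {z}"
  have vertices: "fst L = insert z (A \<union> B)" using cover z by (auto simp: A_def B_def)
  have "snd L = {{a, b} | a b. a \<in> A \<and> b \<in> B}"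
  proof (rule edge_set_eqI)
    fix x y assume xy: "x \<in> fst L" "y \<in> fst L"
    then have "{x, y} \<notin> snd L \<longleftrightarrow> x \<in> I \<and> y \<in> I \<or> x \<in> J \<and> y \<in> J"
      using nonadjacent_iff_common_maximal covering_pair_only_maximal by blast
    then show "{x, y} \<in> snd L \<longleftrightarrow> x \<in> A \<and> y \<in> B \<or> y \<in> A \<and> x \<in> B"
      using xy cover z unfolding A_def B_def by blast
  qed (use vertices in auto)
  moreover have "A \<inter> B = {}" "card A = card B" "finite A" "finite B"
    using z assms maximal finite_maximal by (auto simp: A_def B_def card_Diff_singleton_if)
  ultimately have "balanced_complete_bipartite (A \<union> B, snd L)"
    by (auto simp: balanced_complete_bipartite_def)
  moreover have "isolated_vertex_plus L z (A \<union> B, snd L)"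
    using vertices by (simp add: isolated_vertex_plus_def A_def B_def prod_eq_iff)
  ultimately show ?thesis using covering_pair_only_maximal z by blast
qed

end

end

end

section \<open>Menger's theorem\<close>

definition edges_between :: "('v, 'e) multigraph \<Rightarrow> 'v set \<Rightarrow> 'v set \<Rightarrow> 'e set" where
  "edges_between G A B = {e \<in> edges G. \<exists>a \<in> A. \<exists>b \<in> B. ends G e = {a, b}}"

definition edge_cut :: "('v, 'e) multigraph \<Rightarrow> 'v set \<Rightarrow> 'e set" where
  "edge_cut G X = edges_between G X (- X)"

locale loopless_multigraph =
  fixes G :: "('v, 'e) multigraph"
  assumes finite_loopless: "finite_loopless_multigraph G"
begin

lemma finite_verts: "finite (verts G)" and finite_edges: "finite (edges G)"
  using finite_loopless by (simp_all add: finite_loopless_multigraph_def)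

lemma ends_subset_verts: "e \<in> edges G \<Longrightarrow> ends G e \<subseteq> verts G"
  using finite_loopless by (simp add: finite_loopless_multigraph_def)

lemma ends_obtain:
  assumes "e \<in> edges G"
  obtains x y where "ends G e = {x, y}" "x \<noteq> y" "x \<in> verts G" "y \<in> verts G"
proof -
  have "card (ends G e) = 2"
    using finite_loopless assms by (simp add: finite_loopless_multigraph_def)
  then show ?thesis using that ends_subset_verts[OF assms] by (auto simp: card_2_iff)
qed

lemma finite_edges_between: "finite (edges_between G A B)"
  using finite_edges by (simp add: edges_between_def)

end

text \<open>An arc \<open>(e, x, y)\<close> is the edge \<open>e\<close> traversed from \<open>x\<close> to \<open>y\<close>.\<close>

type_synonym ('v, 'e) arc = "'e \<times> 'v \<times> 'v"

fun arc_walk :: "('v, 'e) arc set \<Rightarrow> 'v \<Rightarrow> ('v, 'e) arc list \<Rightarrow> 'v \<Rightarrow> bool" where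
  "arc_walk A x [] y \<longleftrightarrow> x = y"
| "arc_walk A x ((e, a, b) # p) y \<longleftrightarrow> a = x \<and> (e, a, b) \<in> A \<and> arc_walk A b p y"

lemmas arc_walk_induct = arc_walk.induct [case_names Nil Cons]

abbreviation heads :: "('v, 'e) arc list \<Rightarrow> 'v list" where
  "heads p \<equiv> map (\<lambda>a. snd (snd a)) p"

definition reachable :: "('v, 'e) arc set \<Rightarrow> 'v \<Rightarrow> 'v set" where
  "reachable A u = {w. \<exists>p. arc_walk A u p w}"

definition leaving :: "('v, 'e) arc set \<Rightarrow> 'v set \<Rightarrow> ('v, 'e) arc set" where
  "leaving A R = {(e, x, y) \<in> A. x \<in> R \<and> y \<notin> R}"

lemma arc_walk_append:
  "arc_walk A x (p @ q) y \<longleftrightarrow> (\<exists>z. arc_walk A x p z \<and> arc_walk A z q y)"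
  by (induction A x p y rule: arc_walk_induct) auto

lemma arc_walk_subset: "arc_walk A x p y \<Longrightarrow> set p \<subseteq> A"
  by (induction A x p y rule: arc_walk_induct) auto

lemma arc_walk_vertices:
  "arc_walk A x p y \<Longrightarrow> (e, a, b) \<in> set p \<Longrightarrow> a \<in> set (x # heads p) \<and> b \<in> set (heads p)"
  by (induction A x p y rule: arc_walk_induct) auto

lemma arc_walk_last: "arc_walk A x p y \<Longrightarrow> last (x # heads p) = y"
  by (induction A x p y rule: arc_walk_induct) auto

lemma simple_arc_walk_exists:
  "arc_walk A x p y \<Longrightarrow> \<exists>q. arc_walk A x q y \<and> distinct (x # heads q)"
proof (induction A x p y rule: arc_walk_induct)
  case (Nil A x y)
  then have "arc_walk A x [] y \<and> distinct (x # heads [])" by simp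
  then show ?case by blast
next
  case (Cons A x e a b p y)
  then obtain q where q: "arc_walk A b q y" "distinct (b # heads q)" by auto
  consider (fresh) "x \<notin> set (b # heads q)" | (loop) "x = b" | (revisited) "x \<in> set (heads q)" by auto
  then show ?case
  proof cases
    case fresh
    then have "arc_walk A x ((e, x, b) # q) y \<and> distinct (x # heads ((e, x, b) # q))"
      using Cons q by auto
    then show ?thesis by blast
  next
    case loop
    then show ?thesis using q by blast
  next
    case revisited
    then obtain e' a' q1 q2 where "q = q1 @ (e', a', x) # q2"
      by (auto simp: in_set_conv_decomp)
    then have "arc_walk A x q2 y \<and> distinct (x # heads q2)" using q by (auto simp: arc_walk_append)
    then show ?thesis by blast
  qed
qed

lemma reachable_by_simple_walk:
  assumes "y \<in> reachable A x"
  obtains p where "arc_walk A x p y" "distinct (x # heads p)"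
proof -
  obtain q where "arc_walk A x q y" using assms by (auto simp: reachable_def)
  from simple_arc_walk_exists[OF this] show ?thesis using that by blast
qed

lemma start_reachable: "u \<in> reachable A u"
  by (auto simp: reachable_def intro: exI[of _ "[]"])

lemma leaving_reachable: "leaving A (reachable A u) = {}"
proof -
  have "y \<in> reachable A u" if "(e, x, y) \<in> A" "x \<in> reachable A u" for e x y
  proof -
    obtain p where "arc_walk A u p x" using \<open>x \<in> reachable A u\<close> by (auto simp: reachable_def)
    then have "arc_walk A u (p @ [(e, x, y)]) y" using \<open>(e, x, y) \<in> A\<close> by (simp add: arc_walk_append)
    then show ?thesis unfolding reachable_def by blast
  qed
  then show ?thesis by (auto simp: leaving_def)
qed

lemma reachable_subset:
  assumes "u \<in> S" "leaving A S = {}"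
  shows "reachable A u \<subseteq> S"
proof -
  have "arc_walk A u p w \<Longrightarrow> u \<in> S \<Longrightarrow> leaving A S = {} \<Longrightarrow> w \<in> S" for p w
    by (induction A u p w rule: arc_walk_induct) (auto simp: leaving_def)
  then show ?thesis using assms by (auto simp: reachable_def)
qed

fun rev_arc :: "('v, 'e) arc \<Rightarrow> ('v, 'e) arc" where
  "rev_arc (e, x, y) = (e, y, x)"

lemma rev_arc_rev_arc: "rev_arc (rev_arc a) = a"
  by (cases a) simp

lemma fst_rev_arc: "fst (rev_arc a) = fst a"
  by (cases a) simp

definition net :: "('v, 'e) arc set \<Rightarrow> 'v \<Rightarrow> int" where
  "net F w = (\<Sum>(e, x, y) \<in> F. of_bool (x = w) - of_bool (y = w))"

lemma net_Un_disjoint: "finite A \<Longrightarrow> finite B \<Longrightarrow> A \<inter> B = {} \<Longrightarrow> net (A \<union> B) w = net A w + net B w"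
  by (simp add: net_def sum.union_disjoint)

lemma net_Diff: "finite F \<Longrightarrow> P \<subseteq> F \<Longrightarrow> net (F - P) w = net F w - net P w"
  by (simp add: net_def sum_diff)

lemma net_rev_arc: "net (rev_arc ` A) w = - net A w"
proof -
  have "inj_on rev_arc A" by (metis inj_onI rev_arc_rev_arc)
  then have "net (rev_arc ` A) w = (\<Sum>(e, x, y) \<in> A. of_bool (y = w) - of_bool (x = w))"
    unfolding net_def by (subst sum.reindex) (auto intro: sum.cong)
  also have "\<dots> = - net A w"
    unfolding net_def by (simp add: case_prod_beta flip: sum_negf)
  finally show ?thesis .
qed

lemma net_simple_walk:
  "arc_walk F x p y \<Longrightarrow> distinct (x # heads p) \<Longrightarrow>
     net (set p) w = of_bool (x = w) - of_bool (y = w)"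
proof (induction F x p y rule: arc_walk_induct)
  case (Cons F x e a b p y)
  then have "(e, a, b) \<notin> set p" by force
  then have "net (set ((e, a, b) # p)) w = of_bool (a = w) - of_bool (b = w) + net (set p) w"
    by (simp add: net_def)
  then show ?case using Cons by auto
qed (simp add: net_def)

lemma sum_net:
  assumes "finite F" "finite R"
  shows "(\<Sum>w\<in>R. net F w) = int (card (leaving F R)) - int (card (leaving F (- R)))"
proof -
  have "(\<Sum>w\<in>R. net F w) = (\<Sum>(e, x, y) \<in> F. \<Sum>w\<in>R. of_bool (x = w) - of_bool (y = w))"
    unfolding net_def by (subst sum.swap) (simp add: case_prod_beta)
  also have "\<dots> = (\<Sum>(e, x, y) \<in> F. of_bool (x \<in> R \<and> y \<notin> R) - of_bool (x \<notin> R \<and> y \<in> R))"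
    using assms(2) by (intro sum.cong refl) (auto simp: sum_subtractf of_bool_def)
  also have "\<dots> = int (card (leaving F R)) - int (card (leaving F (- R)))"
    using assms(1) by (simp add: leaving_def case_prod_unfold sum_subtractf Int_def)
  finally show ?thesis .
qed

definition edge_arcs :: "('v, 'e) multigraph \<Rightarrow> ('v, 'e) arc set" where
  "edge_arcs G = {(e, x, y). e \<in> edges G \<and> ends G e = {x, y}}"

definition partial_orientation :: "('v, 'e) multigraph \<Rightarrow> ('v, 'e) arc set \<Rightarrow> bool" where
  "partial_orientation G F \<longleftrightarrow> F \<subseteq> edge_arcs G \<and> inj_on fst F"

definition residual :: "('v, 'e) multigraph \<Rightarrow> ('v, 'e) arc set \<Rightarrow> ('v, 'e) arc set" where
  "residual G F = {a \<in> edge_arcs G. fst a \<notin> fst ` F \<or> rev_arc a \<in> F}"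

definition augment :: "('v, 'e) arc set \<Rightarrow> ('v, 'e) arc set \<Rightarrow> ('v, 'e) arc set" where
  "augment F P = (F - rev_arc ` P) \<union> {a \<in> P. fst a \<notin> fst ` F}"

definition unit_flow :: "('v, 'e) multigraph \<Rightarrow> 'v \<Rightarrow> 'v \<Rightarrow> nat \<Rightarrow> ('v, 'e) arc set \<Rightarrow> bool" where
  "unit_flow G u v j F \<longleftrightarrow>
     partial_orientation G F \<and> (\<forall>w. net F w = int j * (of_bool (u = w) - of_bool (v = w)))"

lemma residual_subset: "residual G F \<subseteq> edge_arcs G"
  by (simp add: residual_def)

lemma partial_orientation_subset:
  "partial_orientation G F \<Longrightarrow> F' \<subseteq> F \<Longrightarrow> partial_orientation G F'"
  by (auto simp: partial_orientation_def intro: inj_on_subset)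

lemma partial_orientation_augment:
  assumes F: "partial_orientation G F" and P: "P \<subseteq> residual G F" "inj_on fst P"
  shows "partial_orientation G (augment F P)"
proof -
  have "inj_on fst (augment F P)"
  proof (rule inj_onI)
    fix a b assume ab: "a \<in> augment F P" "b \<in> augment F P" "fst a = fst b"
    then have "a \<in> F \<and> b \<in> F \<or> a \<in> P \<and> b \<in> P"
      using imageI[of a F fst] imageI[of b F fst] by (auto simp: augment_def)
    then show "a = b" using ab(3) F P(2) unfolding partial_orientation_def inj_on_def by blast
  qed
  moreover have "augment F P \<subseteq> edge_arcs G"
    using F P(1) by (auto simp: partial_orientation_def residual_def augment_def)
  ultimately show ?thesis by (simp add: partial_orientation_def)
qed

lemma net_augment:
  assumes "finite F" "finite P" and P: "P \<subseteq> residual G F"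
  shows "net (augment F P) w = net F w + net P w"
proof -
  define New Back where "New = {a \<in> P. fst a \<notin> fst ` F}" and "Back = {a \<in> P. rev_arc a \<in> F}"
  have finite: "finite New" "finite Back" using assms(2) by (simp_all add: New_def Back_def)
  have Back_not_New: "fst a \<in> fst ` F" if "rev_arc a \<in> F" for a
    using that fst_rev_arc by (metis image_eqI)
  have "augment F P = (F - rev_arc ` Back) \<union> New"
    by (auto simp: augment_def New_def Back_def)
  moreover have "rev_arc ` Back \<subseteq> F" by (auto simp: Back_def)
  moreover have "(F - rev_arc ` Back) \<inter> New = {}" by (auto simp: New_def)
  ultimately have "net (augment F P) w = net F w + net Back w + net New w"
    using assms(1) finite by (simp add: net_Un_disjoint net_Diff net_rev_arc)
  also have "\<dots> = net F w + net (Back \<union> New) w"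
    using finite Back_not_New by (subst net_Un_disjoint) (auto simp: New_def Back_def)
  also have "Back \<union> New = P" using P by (auto simp: New_def Back_def residual_def)
  finally show ?thesis .
qed

context loopless_multigraph
begin

lemma finite_edge_arcs: "finite (edge_arcs G)"
proof (rule finite_subset)
  show "edge_arcs G \<subseteq> edges G \<times> verts G \<times> verts G"
    using ends_subset_verts by (fastforce simp: edge_arcs_def)
qed (simp add: finite_edges finite_verts)

lemma partial_orientation_finite: "partial_orientation G F \<Longrightarrow> finite F"
  using finite_edge_arcs finite_subset by (auto simp: partial_orientation_def)

lemma reachable_subset_verts: "A \<subseteq> edge_arcs G \<Longrightarrow> u \<in> verts G \<Longrightarrow> reachable A u \<subseteq> verts G"
  using ends_subset_verts by (intro reachable_subset) (fastforce simp: leaving_def edge_arcs_def)+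

lemma simple_walk_inj_on_fst:
  "arc_walk A x p y \<Longrightarrow> A \<subseteq> edge_arcs G \<Longrightarrow> distinct (x # heads p) \<Longrightarrow> inj_on fst (set p)"
proof (induction A x p y rule: arc_walk_induct)
  case (Cons A x e a b p y)
  then have walk: "arc_walk A b p y" and "a \<notin> set (b # heads p)" by auto
  have "e' \<noteq> e" if "(e', c, d) \<in> set p" for e' c d
  proof -
    have "ends G e = {a, b}" "ends G e' = {c, d}"
      using Cons arc_walk_subset[OF walk] that by (auto simp: edge_arcs_def)
    moreover have "a \<noteq> c" "a \<noteq> d"
      using arc_walk_vertices[OF walk that] \<open>a \<notin> set (b # heads p)\<close> by auto
    ultimately show ?thesis by (auto simp: doubleton_eq_iff)
  qed
  then show ?case using Cons by (force simp: inj_on_def)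
qed simp

lemma flow_across_cut:
  assumes "unit_flow G u v j F" "finite R" "u \<in> R" "v \<notin> R"
  shows "card (leaving F R) = j + card (leaving F (- R))"
proof -
  have "(\<Sum>w\<in>R. net F w) = (\<Sum>w\<in>R. if w = u then int j else 0)"
    using assms by (intro sum.cong) (auto simp: unit_flow_def)
  also have "\<dots> = int j" using assms(2,3) by simp
  finally show ?thesis
    using sum_net[of F R] assms partial_orientation_finite by (simp add: unit_flow_def)
qed

lemma saturated_cut:
  assumes F: "partial_orientation G F" and closed: "leaving (residual G F) R = {}"
  shows "leaving F (- R) = {}" "edge_cut G R \<subseteq> fst ` leaving F R"
proof -
  have F_arcs: "(e, x, y) \<in> edge_arcs G" if "(e, x, y) \<in> F" for e x y
    using F that by (auto simp: partial_orientation_def)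
  have not_residual: "(e, x, y) \<notin> residual G F" if "x \<in> R" "y \<notin> R" for e x y
    using closed that by (auto simp: leaving_def)
  have "(e, y, x) \<in> residual G F" if "(e, x, y) \<in> F" for e x y
    using F_arcs[OF that] that by (simp add: residual_def edge_arcs_def insert_commute)
  then show "leaving F (- R) = {}" using not_residual by (fastforce simp: leaving_def)
  show "edge_cut G R \<subseteq> fst ` leaving F R"
  proof
    fix e assume "e \<in> edge_cut G R"
    then obtain x y where xy: "(e, x, y) \<in> edge_arcs G" "x \<in> R" "y \<notin> R"
      by (auto simp: edge_cut_def edges_between_def edge_arcs_def)
    then have "e \<in> fst ` F" "(e, y, x) \<notin> F" using not_residual by (auto simp: residual_def)
    then obtain a b where ab: "(e, a, b) \<in> F" by force
    then have "{a, b} = {x, y}" using F_arcs[OF ab] xy by (simp add: edge_arcs_def)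
    then have "(e, x, y) \<in> F" using ab \<open>(e, y, x) \<notin> F\<close> by (auto simp: doubleton_eq_iff)
    then show "e \<in> fst ` leaving F R" using xy by (force simp: leaving_def)
  qed
qed

lemma flow_augmentable:
  assumes F: "unit_flow G u v j F" and u: "u \<in> verts G"
    and cuts: "\<And>X. X \<subseteq> verts G \<Longrightarrow> u \<in> X \<Longrightarrow> v \<notin> X \<Longrightarrow> j < card (edge_cut G X)"
  shows "v \<in> reachable (residual G F) u"
proof (rule ccontr)
  define R where "R = reachable (residual G F) u"
  assume "v \<notin> reachable (residual G F) u"
  then have R: "u \<in> R" "v \<notin> R" by (simp_all add: R_def start_reachable)
  have "R \<subseteq> verts G"
    unfolding R_def by (rule reachable_subset_verts[OF residual_subset u])
  have orientation: "partial_orientation G F" using F by (simp add: unit_flow_def)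
  have "leaving (residual G F) R = {}" unfolding R_def by (rule leaving_reachable)
  note saturated = saturated_cut[OF orientation this]
  have "finite (leaving F R)"
    by (rule finite_subset[OF _ partial_orientation_finite[OF orientation]]) (auto simp: leaving_def)
  then have "card (edge_cut G R) \<le> card (leaving F R)" using saturated(2) surj_card_le by blast
  also have "\<dots> = j"
    using flow_across_cut[OF F _ R] saturated(1) finite_subset[OF \<open>R \<subseteq> verts G\<close> finite_verts] by simp
  finally show False using cuts[OF \<open>R \<subseteq> verts G\<close> R] by simp
qed

lemma flow_exists:
  assumes "u \<in> verts G"
    and cuts: "\<And>X. X \<subseteq> verts G \<Longrightarrow> u \<in> X \<Longrightarrow> v \<notin> X \<Longrightarrow> k \<le> card (edge_cut G X)"
  shows "j \<le> k \<Longrightarrow> \<exists>F. unit_flow G u v j F"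
proof (induction j)
  case 0
  have "unit_flow G u v 0 {}" by (simp add: unit_flow_def partial_orientation_def net_def)
  then show ?case ..
next
  case (Suc j)
  then obtain F where F: "unit_flow G u v j F" by auto
  have "j < card (edge_cut G X)" if "X \<subseteq> verts G" "u \<in> X" "v \<notin> X" for X
    using cuts[OF that] Suc.prems by simp
  then have "v \<in> reachable (residual G F) u" by (rule flow_augmentable[OF F assms(1)])
  then obtain p where walk: "arc_walk (residual G F) u p v" and simple: "distinct (u # heads p)"
    by (rule reachable_by_simple_walk)
  have residual: "set p \<subseteq> residual G F" using walk by (rule arc_walk_subset)
  have "inj_on fst (set p)" by (rule simple_walk_inj_on_fst[OF walk residual_subset simple])
  then have "partial_orientation G (augment F (set p))"
    using F residual by (intro partial_orientation_augment) (simp_all add: unit_flow_def)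
  moreover have "net (augment F (set p)) w = int (Suc j) * (of_bool (u = w) - of_bool (v = w))" for w
  proof -
    have "finite F" "net F w = int j * (of_bool (u = w) - of_bool (v = w))"
      using F partial_orientation_finite by (auto simp: unit_flow_def)
    then show ?thesis
      using net_augment[OF _ _ residual, of w] net_simple_walk[OF walk simple, of w]
      by (simp add: distrib_right)
  qed
  ultimately show ?case unfolding unit_flow_def by blast
qed

lemma flow_carries_path:
  assumes F: "unit_flow G u v (Suc j) F" and "u \<in> verts G"
  obtains p where "arc_walk F u p v" "distinct (u # heads p)" "unit_flow G u v j (F - set p)"
proof -
  have orientation: "partial_orientation G F" using F by (simp add: unit_flow_def)
  have "v \<in> reachable F u"
  proof (rule ccontr)
    assume "v \<notin> reachable F u"
    moreover have "finite (reachable F u)"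
      using reachable_subset_verts[of F u] orientation assms(2) finite_verts finite_subset
      by (auto simp: partial_orientation_def)
    ultimately show False
      using flow_across_cut[OF F _ start_reachable[of u F]] by (simp add: leaving_reachable)
  qed
  then obtain p where walk: "arc_walk F u p v" and simple: "distinct (u # heads p)"
    by (rule reachable_by_simple_walk)
  have "net (F - set p) w = int j * (of_bool (u = w) - of_bool (v = w))" for w
  proof -
    have "net F w = int (Suc j) * (of_bool (u = w) - of_bool (v = w))"
      using F by (simp add: unit_flow_def)
    then show ?thesis
      using net_Diff[OF partial_orientation_finite[OF orientation] arc_walk_subset[OF walk], of w]
        net_simple_walk[OF walk simple, of w] by (simp add: distrib_right)
  qed
  moreover have "partial_orientation G (F - set p)"
    using orientation by (rule partial_orientation_subset) blast
  ultimately show ?thesis using that walk simple by (simp add: unit_flow_def)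
qed

lemma arc_walk_is_walk:
  "arc_walk A x p y \<Longrightarrow> A \<subseteq> edge_arcs G \<Longrightarrow> x \<in> verts G \<Longrightarrow> is_walk G (x # heads p) (map fst p)"
proof (induction A x p y rule: arc_walk_induct)
  case (Cons A x e a b p y)
  then have "e \<in> edges G" "ends G e = {x, b}" by (auto simp: edge_arcs_def)
  moreover from this have "b \<in> verts G" using ends_subset_verts by blast
  ultimately show ?case using Cons by auto
qed simp

lemma flow_decomposition:
  assumes "u \<in> verts G"
  shows "unit_flow G u v j F \<Longrightarrow>
     \<exists>vs es. (\<forall>i<j. is_path G u (vs i) (es i) v \<and> set (es i) \<subseteq> fst ` F) \<and>
             (\<forall>i<j. \<forall>i'<j. i \<noteq> i' \<longrightarrow> set (es i) \<inter> set (es i') = {})"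
proof (induction j arbitrary: F)
  case (Suc j)
  then have F: "F \<subseteq> edge_arcs G" "inj_on fst F"
    by (simp_all add: unit_flow_def partial_orientation_def)
  obtain p where walk: "arc_walk F u p v" and simple: "distinct (u # heads p)"
    and rest: "unit_flow G u v j (F - set p)"
    using flow_carries_path[OF Suc.prems assms] .
  obtain vs es where paths: "\<forall>i<j. is_path G u (vs i) (es i) v \<and> set (es i) \<subseteq> fst ` (F - set p)"
    and disjoint: "\<forall>i<j. \<forall>i'<j. i \<noteq> i' \<longrightarrow> set (es i) \<inter> set (es i') = {}"
    using Suc.IH[OF rest] by blast
  have path: "is_path G u (u # heads p) (map fst p) v"
    using arc_walk_is_walk[OF walk F(1) assms] simple arc_walk_last[OF walk]
    by (simp add: is_path_def)
  have "fst ` (F - set p) \<inter> fst ` set p = {}"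
    using F(2) arc_walk_subset[OF walk] unfolding inj_on_def by blast
  then have new_disjoint: "set (es i) \<inter> set (map fst p) = {}" if "i < j" for i
    using paths that unfolding set_map by blast
  let ?vs = "vs(j := u # heads p)" and ?es = "es(j := map fst p)"
  have "\<forall>i<Suc j. is_path G u (?vs i) (?es i) v \<and> set (?es i) \<subseteq> fst ` F"
    using paths path arc_walk_subset[OF walk] by (auto simp: less_Suc_eq)
  moreover have "\<forall>i<Suc j. \<forall>i'<Suc j. i \<noteq> i' \<longrightarrow> set (?es i) \<inter> set (?es i') = {}"
    using disjoint new_disjoint by (simp add: less_Suc_eq Int_commute all_conj_distrib del: set_map)
  ultimately show ?case by blast
qed simp

lemma walk_crosses_cut:
  "is_walk H vs es \<Longrightarrow> hd vs \<in> X \<Longrightarrow> last vs \<notin> X \<Longrightarrow> set es \<inter> edge_cut H X \<noteq> {}"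
  by (induction H vs es rule: is_walk.induct) (fastforce simp: edge_cut_def edges_between_def)+

lemma edge_disjoint_paths_le_cut:
  assumes joined: "joined_by_edge_disjoint_paths G k u v" and X: "u \<in> X" "v \<notin> X"
  shows "k \<le> card (edge_cut G X)"
proof -
  obtain vs es where paths: "\<And>i. i < k \<Longrightarrow> is_path G u (vs i) (es i) v"
    and disjoint: "\<And>i j. i < k \<Longrightarrow> j < k \<Longrightarrow> i \<noteq> j \<Longrightarrow> set (es i) \<inter> set (es j) = {}"
    using joined unfolding joined_by_edge_disjoint_paths_def by metis
  have "\<forall>i<k. \<exists>e. e \<in> set (es i) \<inter> edge_cut G X"
    using paths walk_crosses_cut X unfolding is_path_def by (metis ex_in_conv)
  then obtain crossing where crossing: "\<And>i. i < k \<Longrightarrow> crossing i \<in> set (es i) \<inter> edge_cut G X"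
    by metis
  then have "inj_on crossing {..<k}" using disjoint by (fastforce simp: inj_on_def)
  moreover have "crossing ` {..<k} \<subseteq> edge_cut G X" using crossing by auto
  ultimately show ?thesis
    using card_inj_on_le[of crossing "{..<k}"] finite_edges_between by (simp add: edge_cut_def)
qed

theorem menger:
  assumes "u \<in> verts G"
  shows "joined_by_edge_disjoint_paths G k u v \<longleftrightarrow>
    (\<forall>X. X \<subseteq> verts G \<and> u \<in> X \<and> v \<notin> X \<longrightarrow> k \<le> card (edge_cut G X))"
proof
  assume "\<forall>X. X \<subseteq> verts G \<and> u \<in> X \<and> v \<notin> X \<longrightarrow> k \<le> card (edge_cut G X)"
  then obtain F where "unit_flow G u v k F" using flow_exists[OF assms, of v k k] by auto
  from flow_decomposition[OF assms this] show "joined_by_edge_disjoint_paths G k u v"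
    unfolding joined_by_edge_disjoint_paths_def by blast
qed (use edge_disjoint_paths_le_cut in blast)

end

section \<open>Cuts\<close>

lemma edges_between_mono: "A \<subseteq> A' \<Longrightarrow> B \<subseteq> B' \<Longrightarrow> edges_between G A B \<subseteq> edges_between G A' B'"
  by (auto simp: edges_between_def)

lemma edges_between_commute: "edges_between G A B = edges_between G B A"
  by (auto simp: edges_between_def insert_commute)

context loopless_multigraph
begin

lemma other_end:
  assumes "e \<in> incident_edges G v"
  shows "ends G e = {v, other_end G v e}" "other_end G v e \<noteq> v" "other_end G v e \<in> verts G"
proof -
  have "e \<in> edges G" "v \<in> ends G e" using assms by (simp_all add: incident_edges_def)
  then obtain w where w: "ends G e = {v, w}" "w \<noteq> v" "w \<in> verts G"
    by (elim ends_obtain) auto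
  then have "ends G e - {v} = {w}" by auto
  then have "other_end G v e = w" by (simp add: other_end_def)
  with w show "ends G e = {v, other_end G v e}" "other_end G v e \<noteq> v" "other_end G v e \<in> verts G"
    by simp_all
qed

text \<open>An arbitrary orientation, so that cut identities can be checked edge by edge.\<close>

definition tail :: "'e \<Rightarrow> 'v" where
  "tail e = (SOME x. x \<in> ends G e)"

definition head :: "'e \<Rightarrow> 'v" where
  "head e = other_end G (tail e) e"

lemma ends_eq_tail_head:
  assumes "e \<in> edges G"
  shows "ends G e = {tail e, head e}"
proof -
  have "\<exists>x. x \<in> ends G e" using assms by (elim ends_obtain) auto
  then have "tail e \<in> ends G e" unfolding tail_def by (rule someI_ex)
  then show ?thesis
    unfolding head_def using assms by (intro other_end) (simp add: incident_edges_def)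
qed

lemma card_edges_between:
  "card (edges_between G A B) =
     (\<Sum>e\<in>edges G. of_bool (tail e \<in> A \<and> head e \<in> B \<or> head e \<in> A \<and> tail e \<in> B))"
proof -
  define P where "P e \<longleftrightarrow> tail e \<in> A \<and> head e \<in> B \<or> head e \<in> A \<and> tail e \<in> B" for e
  have "edges_between G A B = edges G \<inter> {e. P e}"
    by (auto simp: P_def edges_between_def ends_eq_tail_head doubleton_eq_iff) blast+
  then show ?thesis using finite_edges unfolding P_def[symmetric] by simp
qed

lemma card_edge_cut:
  "card (edge_cut G X) = (\<Sum>e\<in>edges G. of_bool ((tail e \<in> X) \<noteq> (head e \<in> X)))"
  unfolding edge_cut_def card_edges_between by (intro sum.cong) auto

lemma edge_cut_Compl: "edge_cut G (- X) = edge_cut G X"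
  by (simp add: edge_cut_def edges_between_commute)

lemma edge_cut_verts_Diff: "edge_cut G (verts G - X) = edge_cut G X"
proof -
  have "edge_cut G (verts G - X) = edge_cut G (- X)"
    using ends_subset_verts by (fastforce simp: edge_cut_def edges_between_def)
  then show ?thesis by (simp add: edge_cut_Compl)
qed

lemma edge_cut_singleton: "edge_cut G {v} = incident_edges G v"
proof -
  have "e \<in> edge_cut G {v} \<longleftrightarrow> e \<in> incident_edges G v" if "e \<in> edges G" for e
    using that by (elim ends_obtain) (auto simp: edge_cut_def edges_between_def incident_edges_def)
  then show ?thesis by (auto simp: edge_cut_def edges_between_def incident_edges_def)
qed

lemma cut_submodular:
  "card (edge_cut G (X \<inter> Y)) + card (edge_cut G (X \<union> Y)) +
     2 * card (edges_between G (X - Y) (Y - X)) =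
     card (edge_cut G X) + card (edge_cut G Y)"
  unfolding card_edge_cut card_edges_between sum_distrib_left sum.distrib[symmetric]
  by (intro sum.cong refl) (auto simp: of_bool_def)

lemma cut_posimodular:
  "card (edge_cut G (X - Y)) + card (edge_cut G (Y - X)) +
     2 * card (edges_between G (X \<inter> Y) (- (X \<union> Y))) =
     card (edge_cut G X) + card (edge_cut G Y)"
proof -
  have "X \<union> - Y = - (Y - X)" "X - - Y = X \<inter> Y" "- Y - X = - (X \<union> Y)" "X \<inter> - Y = X - Y" by auto
  then show ?thesis using cut_submodular[of X "- Y"] by (simp only: edge_cut_Compl)
qed

lemma cut_disjoint_Un:
  assumes "A \<inter> B = {}"
  shows "card (edge_cut G (A \<union> B)) + 2 * card (edges_between G A B) =
    card (edge_cut G A) + card (edge_cut G B)"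
proof -
  have "A - B = A" "B - A = B" using assms by auto
  moreover have "edge_cut G {} = {}" by (simp add: edge_cut_def edges_between_def)
  ultimately show ?thesis using cut_submodular[of A B] assms by simp
qed

lemma cut_three_sets:
  "card (edge_cut G (X \<inter> Y \<inter> Z)) +
     card (edge_cut G (X - Y - Z)) + card (edge_cut G (Y - X - Z)) + card (edge_cut G (Z - X - Y)) +
     2 * card (edges_between G (X \<inter> Y \<union> X \<inter> Z \<union> Y \<inter> Z) (- (X \<union> Y \<union> Z)))
   \<le> card (edge_cut G X) + card (edge_cut G Y) + card (edge_cut G Z)"
  unfolding card_edge_cut card_edges_between sum_distrib_left sum.distrib[symmetric]
proof (rule sum_mono)
  fix e
  show "of_bool ((tail e \<in> X \<inter> Y \<inter> Z) \<noteq> (head e \<in> X \<inter> Y \<inter> Z)) +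
      of_bool ((tail e \<in> X - Y - Z) \<noteq> (head e \<in> X - Y - Z)) +
      of_bool ((tail e \<in> Y - X - Z) \<noteq> (head e \<in> Y - X - Z)) +
      of_bool ((tail e \<in> Z - X - Y) \<noteq> (head e \<in> Z - X - Y)) +
      2 * of_bool (tail e \<in> X \<inter> Y \<union> X \<inter> Z \<union> Y \<inter> Z \<and> head e \<in> - (X \<union> Y \<union> Z) \<or>
        head e \<in> X \<inter> Y \<union> X \<inter> Z \<union> Y \<inter> Z \<and> tail e \<in> - (X \<union> Y \<union> Z))
    \<le> (of_bool ((tail e \<in> X) \<noteq> (head e \<in> X)) + of_bool ((tail e \<in> Y) \<noteq> (head e \<in> Y)) +
      of_bool ((tail e \<in> Z) \<noteq> (head e \<in> Z)) :: nat)"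
    by (cases "tail e \<in> X"; cases "tail e \<in> Y"; cases "tail e \<in> Z";
        cases "head e \<in> X"; cases "head e \<in> Y"; cases "head e \<in> Z") simp_all
qed

end

definition edges_into :: "('v, 'e) multigraph \<Rightarrow> 'v \<Rightarrow> 'v set \<Rightarrow> 'e set" where
  "edges_into G s X = {e \<in> incident_edges G s. other_end G s e \<in> X}"

lemma edges_into_subset: "edges_into G s X \<subseteq> incident_edges G s"
  by (simp add: edges_into_def)

lemma edges_into_Un: "edges_into G s (X \<union> Y) = edges_into G s X \<union> edges_into G s Y"
  by (auto simp: edges_into_def)

lemma edges_into_Int: "edges_into G s (X \<inter> Y) = edges_into G s X \<inter> edges_into G s Y"
  by (auto simp: edges_into_def)

lemma edges_into_mono: "X \<subseteq> Y \<Longrightarrow> edges_into G s X \<subseteq> edges_into G s Y"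
  by (auto simp: edges_into_def)

context loopless_multigraph
begin

lemma finite_incident_edges: "finite (incident_edges G s)"
  using finite_edges by (simp add: incident_edges_def)

lemma finite_edges_into: "finite (edges_into G s X)"
  by (rule finite_subset[OF edges_into_subset finite_incident_edges])

lemma edges_into_eq_edges_between: "edges_into G s X = edges_between G {s} X"
proof (intro equalityI subsetI)
  fix e assume "e \<in> edges_into G s X"
  then show "e \<in> edges_between G {s} X"
    using other_end(1)[of e s] by (auto simp: edges_into_def edges_between_def incident_edges_def)
next
  fix e assume "e \<in> edges_between G {s} X"
  then obtain x where x: "x \<in> X" "ends G e = {s, x}" and e: "e \<in> incident_edges G s"
    by (auto simp: edges_between_def incident_edges_def)
  then have "other_end G s e = x" using other_end(1,2)[OF e] by (auto simp: doubleton_eq_iff)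
  then show "e \<in> edges_into G s X" using x e by (simp add: edges_into_def)
qed

lemma edges_into_subset_edges_between: "s \<in> B \<Longrightarrow> edges_into G s A \<subseteq> edges_between G A B"
  unfolding edges_into_eq_edges_between
  by (subst edges_between_commute) (intro edges_between_mono, auto)

lemma cut_relative_complement:
  assumes "s \<notin> X"
  shows "card (edge_cut G (verts G - {s} - X)) + 2 * card (edges_into G s X) =
    card (edge_cut G X) + degree G s"
proof -
  have "verts G - {s} - X = verts G - ({s} \<union> X)" by auto
  then have "edge_cut G (verts G - {s} - X) = edge_cut G ({s} \<union> X)"
    by (simp only: edge_cut_verts_Diff)
  then show ?thesis
    using cut_disjoint_Un[of "{s}" X] assms
    by (simp add: edges_into_eq_edges_between edge_cut_singleton degree_def)
qed

end

section \<open>Lifting\<close>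

lemma sk_edge_connected_iff_cuts:
  "sk_edge_connected G s k \<longleftrightarrow>
     finite_loopless_multigraph G \<and> card (verts G) \<ge> 3 \<and> s \<in> verts G \<and> k > 0 \<and>
     (\<forall>X. X \<noteq> {} \<and> X \<subset> verts G - {s} \<longrightarrow> k \<le> card (edge_cut G X))"
proof (cases "finite_loopless_multigraph G")
  case True
  then interpret loopless_multigraph G by unfold_locales
  have "(\<forall>u \<in> verts G - {s}. \<forall>v \<in> verts G - {s}. u \<noteq> v \<longrightarrow> joined_by_edge_disjoint_paths G k u v) \<longleftrightarrow>
      (\<forall>X. X \<noteq> {} \<and> X \<subset> verts G - {s} \<longrightarrow> k \<le> card (edge_cut G X))" (is "?paths \<longleftrightarrow> ?cuts")
  proof
    assume paths: ?paths
    show ?cuts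
    proof (intro allI impI)
      fix X assume "X \<noteq> {} \<and> X \<subset> verts G - {s}"
      then obtain u v where uv: "u \<in> X" "v \<notin> X" "u \<in> verts G - {s}" "v \<in> verts G - {s}"
        by blast
      then have "joined_by_edge_disjoint_paths G k u v" using paths by metis
      then show "k \<le> card (edge_cut G X)" by (rule edge_disjoint_paths_le_cut[OF _ uv(1,2)])
    qed
  next
    assume cuts: ?cuts
    have "k \<le> card (edge_cut G X)"
      if "u \<in> verts G - {s}" "v \<in> verts G - {s}" "X \<subseteq> verts G" "u \<in> X" "v \<notin> X" for u v X
    proof (cases "s \<in> X")
      case True
      then have "verts G - X \<noteq> {} \<and> verts G - X \<subset> verts G - {s}" using that by auto
      then show ?thesis using cuts edge_cut_verts_Diff by metis
    next
      case False
      then have "X \<noteq> {} \<and> X \<subset> verts G - {s}" using that by auto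
      then show ?thesis using cuts by blast
    qed
    then show ?paths by (simp add: menger)
  qed
  then show ?thesis by (simp add: sk_edge_connected_def)
qed (simp add: sk_edge_connected_def)

context loopless_multigraph
begin

context
  fixes s e f
  assumes e: "e \<in> incident_edges G s" and f: "f \<in> incident_edges G s" and distinct: "e \<noteq> f"
begin

lemma verts_lift_pair: "verts (lift_pair G s e f) = verts G"
  by (simp add: lift_pair_def Let_def)

lemma finite_loopless_lift_pair: "finite_loopless_multigraph (lift_pair G s e f)"
  using finite_loopless other_end(3)[OF e] other_end(3)[OF f]
  by (auto simp: lift_pair_def Let_def finite_loopless_multigraph_def card_insert_if)

lemma edge_cut_lift_pair:
  "edge_cut (lift_pair G s e f) X = edge_cut G X - {e, f} \<union>
     (if other_end G s e \<in> X \<longleftrightarrow> other_end G s f \<in> X then {} else {e})"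
proof (cases "other_end G s e = other_end G s f")
  case True
  then show ?thesis by (auto simp: lift_pair_def edge_cut_def edges_between_def)
next
  case False
  then show ?thesis
    by (auto simp: lift_pair_def Let_def edge_cut_def edges_between_def doubleton_eq_iff)
qed

lemma card_edge_cut_lift_pair:
  assumes "s \<notin> X"
  shows "card (edge_cut (lift_pair G s e f) X) + (if {e, f} \<subseteq> edges_into G s X then 2 else 0) =
    card (edge_cut G X)"
proof -
  have at_s: "g \<in> edge_cut G X \<longleftrightarrow> other_end G s g \<in> X" if "g \<in> incident_edges G s" for g
    using other_end(1)[OF that] that assms
    by (auto simp: edge_cut_def edges_between_def incident_edges_def doubleton_eq_iff)
  have "card (edge_cut G X \<inter> {e, f}) = of_bool (other_end G s e \<in> X) + of_bool (other_end G s f \<in> X)"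
    using distinct by (simp add: Int_insert_right at_s e f)
  moreover have finite: "finite (edge_cut G X)" using finite_edges_between by (simp add: edge_cut_def)
  moreover have "card (edge_cut (lift_pair G s e f) X) = card (edge_cut G X - {e, f}) +
      of_bool ((other_end G s e \<in> X) \<noteq> (other_end G s f \<in> X))"
    using finite by (simp add: edge_cut_lift_pair)
  ultimately show ?thesis
    using card_Int_Diff[of "edge_cut G X" "{e, f}"] e f by (auto simp: edges_into_def)
qed

end

end

section \<open>Dangerous sets\<close>

locale sk_connected_graph =
  fixes G :: "('v, 'e) multigraph" and s :: 'v and k :: nat
  assumes sk_connected: "sk_edge_connected G s k"

sublocale sk_connected_graph \<subseteq> loopless_multigraph G
  using sk_connected by unfold_locales (simp add: sk_edge_connected_def)

context sk_connected_graph
begin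

abbreviation "U \<equiv> verts G - {s}"
abbreviation "D \<equiv> degree G s"
abbreviation "d X \<equiv> card (edge_cut G X)"
abbreviation "\<sigma> X \<equiv> edges_into G s X"
abbreviation "L \<equiv> lifting_graph G s k"

lemma cut_ge: "X \<noteq> {} \<Longrightarrow> X \<subset> U \<Longrightarrow> k \<le> d X"
  using sk_connected by (simp add: sk_edge_connected_iff_cuts)

lemma card_edges_into_bound:
  assumes "X \<noteq> {}" "X \<subset> U"
  shows "2 * card (\<sigma> X) + k \<le> d X + D"
proof -
  have "k \<le> d (U - X)" using assms by (intro cut_ge) auto
  moreover have "s \<notin> X" using assms(2) by auto
  ultimately show ?thesis using cut_relative_complement[of s X] by linarith
qed

lemma edges_into_U: "\<sigma> U = incident_edges G s"
  using other_end(2,3)[of _ s] by (auto simp: edges_into_def)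

definition dangerous :: "'v set \<Rightarrow> bool" where
  "dangerous X \<longleftrightarrow> X \<noteq> {} \<and> X \<subset> U \<and> d X \<le> k + 1"

definition obstructed :: "'e \<Rightarrow> 'e \<Rightarrow> bool" where
  "obstructed e f \<longleftrightarrow> (\<exists>X. dangerous X \<and> e \<in> \<sigma> X \<and> f \<in> \<sigma> X)"

lemma dangerousD:
  assumes "dangerous X"
  shows "X \<noteq> {}" "X \<subset> U" "d X \<le> k + 1" "s \<notin> X"
  using assms by (auto simp: dangerous_def)

lemma card_edges_into_dangerous: "dangerous X \<Longrightarrow> 2 * card (\<sigma> X) \<le> D + 1"
  using card_edges_into_bound[of X] by (auto simp: dangerous_def)

lemma obstructed_sym: "obstructed e f \<longleftrightarrow> obstructed f e"
  by (auto simp: obstructed_def)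

lemma liftable_iff_not_obstructed:
  assumes ef: "e \<in> incident_edges G s" "f \<in> incident_edges G s" "e \<noteq> f"
  shows "liftable_pair G s k e f \<longleftrightarrow> \<not> obstructed e f"
proof -
  have lift_cut_ge_iff: "k \<le> card (edge_cut (lift_pair G s e f) X) \<longleftrightarrow>
      \<not> (dangerous X \<and> e \<in> \<sigma> X \<and> f \<in> \<sigma> X)"
    if "X \<noteq> {} \<and> X \<subset> U" for X
  proof -
    have "s \<notin> X" using that by auto
    then show ?thesis
      using card_edge_cut_lift_pair[OF ef, of X] cut_ge[of X] that
      by (auto simp: dangerous_def split: if_splits)
  qed
  have "liftable_pair G s k e f \<longleftrightarrow>
      (\<forall>X. X \<noteq> {} \<and> X \<subset> U \<longrightarrow> k \<le> card (edge_cut (lift_pair G s e f) X))"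
    using sk_connected ef finite_loopless_lift_pair[OF ef] verts_lift_pair[OF ef]
    by (simp add: liftable_pair_def sk_edge_connected_iff_cuts)
  also have "\<dots> \<longleftrightarrow> (\<forall>X. X \<noteq> {} \<and> X \<subset> U \<longrightarrow> \<not> (dangerous X \<and> e \<in> \<sigma> X \<and> f \<in> \<sigma> X))"
    using lift_cut_ge_iff by blast
  also have "\<dots> \<longleftrightarrow> \<not> obstructed e f"
    by (auto simp: obstructed_def dangerous_def)
  finally show ?thesis .
qed

lemma fst_lifting_graph: "fst L = incident_edges G s"
  by (simp add: lifting_graph_def)

lemma adjacent_iff:
  assumes "e \<in> incident_edges G s" "f \<in> incident_edges G s"
  shows "{e, f} \<in> snd L \<longleftrightarrow> e \<noteq> f \<and> \<not> obstructed e f"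
proof -
  have "{e, f} \<in> snd L \<longleftrightarrow> liftable_pair G s k e f \<or> liftable_pair G s k f e"
    by (auto simp: lifting_graph_def doubleton_eq_iff)
  also have "\<dots> \<longleftrightarrow> e \<noteq> f \<and> \<not> obstructed e f"
    using assms liftable_iff_not_obstructed obstructed_sym
    by (cases "e = f") (auto simp: liftable_pair_def)
  finally show ?thesis .
qed

sublocale finite_sgraph L
proof
  show "finite (fst L)" by (simp add: fst_lifting_graph finite_incident_edges)
  show "\<exists>e \<in> fst L. \<exists>f \<in> fst L. e \<noteq> f \<and> p = {e, f}" if "p \<in> snd L" for p
    using that by (auto simp: lifting_graph_def liftable_pair_def)
qed

lemma independent_iff:
  "independent_set L I \<longleftrightarrow> I \<subseteq> incident_edges G s \<and> pairwise obstructed I"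
proof (cases "I \<subseteq> incident_edges G s")
  case True
  then have "{e, f} \<notin> snd L \<longleftrightarrow> e \<noteq> f \<longrightarrow> obstructed e f" if "e \<in> I" "f \<in> I" for e f
    using adjacent_iff[of e f] that by blast
  then show ?thesis using True by (simp add: independent_set_def fst_lifting_graph pairwise_def)
qed (simp add: independent_set_def fst_lifting_graph)

lemma obstructed_if_independent:
  "independent_set L I \<Longrightarrow> e \<in> I \<Longrightarrow> f \<in> I \<Longrightarrow> e \<noteq> f \<Longrightarrow> obstructed e f"
  by (simp add: independent_iff pairwise_def)

lemma independent_edges_into: "dangerous X \<Longrightarrow> independent_set L (\<sigma> X)"
  using edges_into_subset[of G s X] by (auto simp: independent_iff pairwise_def obstructed_def)

section \<open>Crossing dangerous sets\<close>

definition crossing :: "'v set \<Rightarrow> 'v set \<Rightarrow> bool" where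
  "crossing X Y \<longleftrightarrow> dangerous X \<and> dangerous Y \<and> \<sigma> X \<inter> \<sigma> Y \<noteq> {} \<and> X - Y \<noteq> {} \<and> Y - X \<noteq> {}"

lemma crossing_sym: "crossing X Y \<Longrightarrow> crossing Y X"
  by (auto simp: crossing_def)

lemma crossing_tight:
  assumes "crossing X Y"
  shows "card (\<sigma> X \<inter> \<sigma> Y) = 1" "d X = k + 1" "d (X - Y) = k"
proof -
  have X: "dangerous X" and Y: "dangerous Y" using assms by (simp_all add: crossing_def)
  have "0 < card (\<sigma> X \<inter> \<sigma> Y)"
    using assms finite_edges_into by (simp add: crossing_def card_gt_0_iff)
  moreover have "\<sigma> X \<inter> \<sigma> Y \<subseteq> edges_between G (X \<inter> Y) (- (X \<union> Y))"
    using dangerousD(4)[OF X] dangerousD(4)[OF Y]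
    unfolding edges_into_Int[symmetric] by (intro edges_into_subset_edges_between) simp
  then have "card (\<sigma> X \<inter> \<sigma> Y) \<le> card (edges_between G (X \<inter> Y) (- (X \<union> Y)))"
    by (rule card_mono[OF finite_edges_between])
  moreover have "k \<le> d (X - Y)" "k \<le> d (Y - X)"
    using assms dangerousD(2)[OF X] dangerousD(2)[OF Y] by (auto simp: crossing_def intro!: cut_ge)
  ultimately show "card (\<sigma> X \<inter> \<sigma> Y) = 1" "d X = k + 1" "d (X - Y) = k"
    using cut_posimodular[of X Y] dangerousD(3)[OF X] dangerousD(3)[OF Y] by linarith+
qed

lemma dangerous_nested_if_share_two:
  assumes "dangerous X" "dangerous Y" "e \<in> \<sigma> X \<inter> \<sigma> Y" "f \<in> \<sigma> X \<inter> \<sigma> Y" "e \<noteq> f"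
  shows "X \<subseteq> Y \<or> Y \<subseteq> X"
proof (rule ccontr)
  assume "\<not> (X \<subseteq> Y \<or> Y \<subseteq> X)"
  then have "crossing X Y" using assms by (auto simp: crossing_def)
  then have "card (\<sigma> X \<inter> \<sigma> Y) \<le> Suc 0" by (simp add: crossing_tight(1))
  then show False using assms finite_edges_into by (auto simp: card_le_Suc0_iff_eq)
qed

lemma crossing_covering:
  assumes "crossing X Y" "X \<union> Y = U"
  shows "2 * card (\<sigma> X) = D + 1"
proof -
  have "s \<notin> X" using assms(2) by auto
  moreover have "U - X = Y - X" using assms(2) by auto
  ultimately show ?thesis
    using cut_relative_complement[of s X] crossing_tight(2)[OF assms(1)]
      crossing_tight(3)[OF crossing_sym[OF assms(1)]] by simp
qed

lemma crossing_Int_ge: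
  assumes "crossing X Y"
  shows "k \<le> d (X \<inter> Y)"
proof (rule cut_ge)
  show "X \<inter> Y \<noteq> {}" using assms by (auto simp: crossing_def edges_into_def)
qed (use assms in \<open>auto simp: crossing_def dangerous_def\<close>)

lemma crossing_Int_odd:
  assumes "crossing X Y"
  shows "odd (d (X \<inter> Y))"
proof -
  have "(X - Y) \<union> (X \<inter> Y) = X" by auto
  then have "d X + 2 * card (edges_between G (X - Y) (X \<inter> Y)) = d (X - Y) + d (X \<inter> Y)"
    using cut_disjoint_Un[of "X - Y" "X \<inter> Y"] by auto
  then have "1 + 2 * card (edges_between G (X - Y) (X \<inter> Y)) = d (X \<inter> Y)"
    using crossing_tight[OF assms] by simp
  then show ?thesis by presburger
qed

lemma crossing_union:
  assumes XY: "crossing X Y" and "X \<union> Y \<noteq> U"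
  shows "X \<union> Y \<subset> U" "d (X \<union> Y) \<le> k + 2" "even k \<Longrightarrow> dangerous (X \<union> Y)"
proof -
  show proper: "X \<union> Y \<subset> U" using assms by (auto simp: crossing_def dangerous_def)
  have sum: "d (X \<inter> Y) + d (X \<union> Y) \<le> 2 * k + 2"
    using cut_submodular[of X Y] crossing_tight(2)[OF XY] crossing_tight(2)[OF crossing_sym[OF XY]]
    by linarith
  then show "d (X \<union> Y) \<le> k + 2" using crossing_Int_ge[OF XY] by linarith
  assume "even k"
  then have "d (X \<inter> Y) \<noteq> k" using crossing_Int_odd[OF XY] by auto
  then have "d (X \<union> Y) \<le> k + 1" using sum crossing_Int_ge[OF XY] by linarith
  then show "dangerous (X \<union> Y)" using XY proper by (auto simp: crossing_def dangerous_def)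
qed

section \<open>Three pairwise obstructed edges\<close>

definition dangerous_triangle :: "'v set \<Rightarrow> 'v set \<Rightarrow> 'v set \<Rightarrow> bool" where
  "dangerous_triangle X Y Z \<longleftrightarrow> dangerous X \<and> dangerous Y \<and> dangerous Z \<and>
     \<sigma> X \<inter> \<sigma> Y - \<sigma> Z \<noteq> {} \<and> \<sigma> X \<inter> \<sigma> Z - \<sigma> Y \<noteq> {} \<and> \<sigma> Y \<inter> \<sigma> Z - \<sigma> X \<noteq> {}"

lemma dangerous_triangle_permute:
  assumes "dangerous_triangle X Y Z"
  shows "dangerous_triangle X Z Y" "dangerous_triangle Y Z X"
  using assms by (auto simp: dangerous_triangle_def Int_commute)

lemma dangerous_triangleD:
  assumes "dangerous_triangle X Y Z"
  shows "crossing X Y" "X \<inter> Y - Z \<noteq> {}"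
  using assms by (auto simp: dangerous_triangle_def crossing_def edges_into_def)

lemma triangle_not_covering:
  assumes XYZ: "dangerous_triangle X Y Z" and "D \<ge> 4"
  shows "X \<union> Y \<noteq> U"
proof
  assume cover: "X \<union> Y = U"
  have XY: "crossing X Y" and XZ: "crossing X Z" and YZ: "crossing Y Z"
    using XYZ dangerous_triangle_permute dangerous_triangleD(1) by blast+
  have card_X: "2 * card (\<sigma> X) = D + 1" using crossing_covering[OF XY cover] .
  have "\<sigma> Z \<subseteq> \<sigma> X \<union> \<sigma> Y"
    using edges_into_subset unfolding edges_into_Un[symmetric] cover edges_into_U .
  then have "\<sigma> Z = (\<sigma> X \<inter> \<sigma> Z) \<union> (\<sigma> Y \<inter> \<sigma> Z)" by blast
  then have "card (\<sigma> Z) \<le> card (\<sigma> X \<inter> \<sigma> Z) + card (\<sigma> Y \<inter> \<sigma> Z)" by (metis card_Un_le)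
  then have card_Z: "card (\<sigma> Z) \<le> 2" using crossing_tight(1)[OF XZ] crossing_tight(1)[OF YZ] by simp
  have "X \<union> Z \<noteq> U"
  proof
    assume "X \<union> Z = U"
    then have "Z \<union> X = U" by auto
    then have "2 * card (\<sigma> Z) = D + 1" by (rule crossing_covering[OF crossing_sym[OF XZ]])
    then show False using card_X card_Z \<open>D \<ge> 4\<close> by presburger
  qed
  note XuZ = crossing_union[OF XZ this]
  have "\<sigma> X \<subset> \<sigma> (X \<union> Z)"
    using XYZ by (auto simp: dangerous_triangle_def edges_into_Un)
  then have "card (\<sigma> X) < card (\<sigma> (X \<union> Z))" by (rule psubset_card_mono[OF finite_edges_into])
  moreover have "2 * card (\<sigma> (X \<union> Z)) + k \<le> d (X \<union> Z) + D"
    using XZ XuZ(1) by (intro card_edges_into_bound) (auto simp: crossing_def dangerous_def)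
  ultimately show False using card_X XuZ(2) by linarith
qed

lemma triangle_nondangerous_union:
  assumes XYZ: "dangerous_triangle X Y Z" and "D \<ge> 4" and "\<not> dangerous (X \<union> Y)"
  shows "d (X \<inter> Y) = k" "edges_between G (X - Y) (Y - X) = {}"
proof -
  have XY: "crossing X Y" by (rule dangerous_triangleD(1)[OF XYZ])
  have "X \<union> Y \<subset> U" by (rule crossing_union(1)[OF XY triangle_not_covering[OF XYZ \<open>D \<ge> 4\<close>]])
  then have "k + 2 \<le> d (X \<union> Y)"
    using XY \<open>\<not> dangerous (X \<union> Y)\<close> by (auto simp: crossing_def dangerous_def)
  then have "d (X \<inter> Y) = k \<and> card (edges_between G (X - Y) (Y - X)) = 0"
    using cut_submodular[of X Y] crossing_Int_ge[OF XY] crossing_tight(2)[OF XY]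
      crossing_tight(2)[OF crossing_sym[OF XY]] by linarith
  then show "d (X \<inter> Y) = k" "edges_between G (X - Y) (Y - X) = {}"
    using finite_edges_between by simp_all
qed

text \<open>If \<open>X \<subseteq> Y \<union> Z\<close>, no edge joins the parts \<open>X \<inter> Y\<close> and \<open>X \<inter> Z\<close> of \<open>X\<close>, whence \<open>d(X) \<ge> 2k\<close>.\<close>

lemma dangerous_not_split:
  assumes X: "dangerous X" and "k \<ge> 2"
    and parts: "k \<le> d (X \<inter> Y)" "k \<le> d (X \<inter> Z)" "X \<inter> Y \<inter> Z = {}"
    and separated: "edges_between G (Y - Z) (Z - Y) = {}"
  shows "X - Y - Z \<noteq> {}"
proof
  assume "X - Y - Z = {}"
  then have "X \<inter> Y \<union> X \<inter> Z = X" by auto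
  moreover have "edges_between G (X \<inter> Y) (X \<inter> Z) \<subseteq> edges_between G (Y - Z) (Z - Y)"
    using parts(3) by (intro edges_between_mono) auto
  ultimately have "d X = d (X \<inter> Y) + d (X \<inter> Z)"
    using cut_disjoint_Un[of "X \<inter> Y" "X \<inter> Z"] parts(3) separated by (simp add: Int_ac)
  then show False using parts(1,2) dangerousD(3)[OF X] \<open>k \<ge> 2\<close> by linarith
qed

lemma triangle_disjoint:
  assumes XYZ: "dangerous_triangle X Y Z"
    and pairs: "d (X \<inter> Y) = k" "d (X \<inter> Z) = k" "d (Y \<inter> Z) = k"
  shows "X \<inter> Y \<inter> Z = {}"
proof (rule ccontr)
  assume "X \<inter> Y \<inter> Z \<noteq> {}"
  moreover have "X \<inter> Y - Z \<noteq> {}" "X \<inter> Z - Y \<noteq> {}" "Y \<inter> Z - X \<noteq> {}"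
    using XYZ dangerous_triangle_permute dangerous_triangleD(2) by blast+
  moreover have "X \<subset> U" "Y \<subset> U"
    using XYZ by (auto simp: dangerous_triangle_def dangerous_def)
  ultimately have "k \<le> d (X \<inter> Y \<inter> Z)" "k \<le> d (X \<inter> Y - Z)" "k \<le> d (X \<inter> Z - Y)" "k \<le> d (Y \<inter> Z - X)"
    by (auto intro!: cut_ge)
  moreover have "X \<inter> Y \<inter> (X \<inter> Z) \<inter> (Y \<inter> Z) = X \<inter> Y \<inter> Z" "X \<inter> Y - X \<inter> Z - Y \<inter> Z = X \<inter> Y - Z"
    "X \<inter> Z - X \<inter> Y - Y \<inter> Z = X \<inter> Z - Y" "Y \<inter> Z - X \<inter> Y - X \<inter> Z = Y \<inter> Z - X" by auto
  moreover have "0 < k" using sk_connected by (simp add: sk_edge_connected_def)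
  ultimately show False
    using cut_three_sets[of "X \<inter> Y" "X \<inter> Z" "Y \<inter> Z"] pairs by simp
qed

lemma triangle_edges_ge_3:
  assumes "dangerous_triangle X Y Z"
  shows "3 \<le> card (edges_between G (X \<inter> Y \<union> X \<inter> Z \<union> Y \<inter> Z) (- (X \<union> Y \<union> Z)))"
proof -
  obtain e f g where efg: "e \<in> \<sigma> X \<inter> \<sigma> Y - \<sigma> Z" "f \<in> \<sigma> X \<inter> \<sigma> Z - \<sigma> Y" "g \<in> \<sigma> Y \<inter> \<sigma> Z - \<sigma> X"
    using assms by (auto simp: dangerous_triangle_def)
  have "s \<in> - (X \<union> Y \<union> Z)" using assms by (auto simp: dangerous_triangle_def dangerous_def)
  then have "\<sigma> (X \<inter> Y \<union> X \<inter> Z \<union> Y \<inter> Z) \<subseteq> edges_between G (X \<inter> Y \<union> X \<inter> Z \<union> Y \<inter> Z) (- (X \<union> Y \<union> Z))"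
    by (rule edges_into_subset_edges_between)
  moreover have "{e, f, g} \<subseteq> \<sigma> (X \<inter> Y \<union> X \<inter> Z \<union> Y \<inter> Z)"
    using efg by (auto simp: edges_into_Un edges_into_Int)
  moreover have "card {e, f, g} = 3" using efg by (auto simp: card_insert_if)
  ultimately show ?thesis using card_mono[OF finite_edges_between] by (metis subset_trans)
qed

lemma triangle_union_dangerous:
  assumes XYZ: "dangerous_triangle X Y Z" and "k \<ge> 2" "D \<ge> 4"
  shows "dangerous (X \<union> Y) \<or> dangerous (X \<union> Z) \<or> dangerous (Y \<union> Z)"
proof (rule ccontr)
  assume "\<not> (dangerous (X \<union> Y) \<or> dangerous (X \<union> Z) \<or> dangerous (Y \<union> Z))"
  then have unions: "\<not> dangerous (X \<union> Y)" "\<not> dangerous (X \<union> Z)" "\<not> dangerous (Y \<union> Z)" by simp_all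
  have dangerous: "dangerous X" "dangerous Y" "dangerous Z"
    using XYZ by (simp_all add: dangerous_triangle_def)
  note XZY = dangerous_triangle_permute(1)[OF XYZ] and YZX = dangerous_triangle_permute(2)[OF XYZ]
  note XY = triangle_nondangerous_union[OF XYZ \<open>D \<ge> 4\<close> unions(1)]
    and XZ = triangle_nondangerous_union[OF XZY \<open>D \<ge> 4\<close> unions(2)]
    and YZ = triangle_nondangerous_union[OF YZX \<open>D \<ge> 4\<close> unions(3)]
  have "X \<inter> Y \<inter> Z = {}" by (rule triangle_disjoint[OF XYZ XY(1) XZ(1) YZ(1)])
  then have "X - Y - Z \<noteq> {}" "Y - X - Z \<noteq> {}" "Z - X - Y \<noteq> {}"
    using dangerous_not_split[of X Y Z] dangerous_not_split[of Y X Z] dangerous_not_split[of Z X Y]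
      dangerous XY XZ YZ \<open>k \<ge> 2\<close> by (simp_all add: Int_ac)
  then have "k \<le> d (X - Y - Z)" "k \<le> d (Y - X - Z)" "k \<le> d (Z - X - Y)"
    using dangerous by (auto simp: dangerous_def intro!: cut_ge)
  then show False
    using cut_three_sets[of X Y Z] triangle_edges_ge_3[OF XYZ] dangerous[THEN dangerousD(3)]
    by linarith
qed

lemma obstructed_triple_common_dangerous:
  assumes "obstructed e f" "obstructed e g" "obstructed f g" and "k \<ge> 2" "D \<ge> 4"
  obtains W where "dangerous W" "{e, f, g} \<subseteq> \<sigma> W"
proof -
  obtain X Y Z where X: "dangerous X" "e \<in> \<sigma> X" "f \<in> \<sigma> X" and Y: "dangerous Y" "e \<in> \<sigma> Y" "g \<in> \<sigma> Y"
    and Z: "dangerous Z" "f \<in> \<sigma> Z" "g \<in> \<sigma> Z"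
    using assms(1-3) by (auto simp: obstructed_def)
  show ?thesis
  proof (cases "g \<in> \<sigma> X \<or> f \<in> \<sigma> Y \<or> e \<in> \<sigma> Z")
    case True
    then show ?thesis using that X Y Z by blast
  next
    case False
    then have "dangerous_triangle X Y Z" using X Y Z by (auto simp: dangerous_triangle_def)
    then have "dangerous (X \<union> Y) \<or> dangerous (X \<union> Z) \<or> dangerous (Y \<union> Z)"
      using assms(4,5) by (rule triangle_union_dangerous)
    moreover have "{e, f, g} \<subseteq> \<sigma> (X \<union> Y)" "{e, f, g} \<subseteq> \<sigma> (X \<union> Z)" "{e, f, g} \<subseteq> \<sigma> (Y \<union> Z)"
      using X Y Z by (auto simp: edges_into_Un)
    ultimately show ?thesis using that by blast
  qed
qed

text \<open>The dangerous sets receiving both \<open>e\<close> and \<open>f\<close> form a chain.\<close>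

lemma greatest_dangerous_set:
  assumes "obstructed e f" "e \<noteq> f"
  obtains X where "dangerous X" "\<forall>W. dangerous W \<and> {e, f} \<subseteq> \<sigma> W \<longrightarrow> W \<subseteq> X"
proof -
  define C where "C = {X. dangerous X \<and> {e, f} \<subseteq> \<sigma> X}"
  have "C \<noteq> {}" using assms(1) by (auto simp: C_def obstructed_def)
  moreover have "finite C"
    by (rule finite_subset[of _ "Pow (verts G)"]) (auto simp: C_def dangerous_def finite_verts)
  ultimately obtain X where X: "X \<in> C" "\<And>W. W \<in> C \<Longrightarrow> X \<subseteq> W \<Longrightarrow> X = W"
    using finite_has_maximal[of C] by auto
  have "W \<subseteq> X" if "W \<in> C" for W
  proof -
    have "X \<subseteq> W \<or> W \<subseteq> X"
      using X(1) that assms(2) by (intro dangerous_nested_if_share_two[of X W e f]) (auto simp: C_def)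
    then show ?thesis using X(2) that by blast
  qed
  then show ?thesis using that[of X] X(1) by (simp add: C_def)
qed

end

section \<open>The lifting graph\<close>

locale sk_lifting_graph = sk_connected_graph +
  assumes k_ge_2: "k \<ge> 2" and degree_ge_4: "D \<ge> 4"
begin

lemma maximal_sets_through_pair:
  assumes "obstructed e f" "e \<noteq> f"
  obtains X where "dangerous X" "\<forall>I. maximal_independent_set L I \<and> e \<in> I \<and> f \<in> I \<longrightarrow> I = \<sigma> X"
proof -
  obtain X where X: "dangerous X" "\<forall>W. dangerous W \<and> {e, f} \<subseteq> \<sigma> W \<longrightarrow> W \<subseteq> X"
    using greatest_dangerous_set[OF assms] .
  have "I = \<sigma> X" if I: "maximal_independent_set L I" "e \<in> I" "f \<in> I" for I
  proof -
    note maximal = maximal_independent_setD[OF I(1)]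
    have "g \<in> \<sigma> X" if g: "g \<in> I" for g
    proof -
      have "\<exists>W. dangerous W \<and> {e, f, g} \<subseteq> \<sigma> W"
      proof (cases "g = e \<or> g = f")
        case True
        then show ?thesis using assms(1) by (auto simp: obstructed_def)
      next
        case False
        then have "obstructed e g" and "obstructed f g"
          using obstructed_if_independent[OF maximal(1)] I(2,3) g by auto
        from obstructed_triple_common_dangerous[OF assms(1) this k_ge_2 degree_ge_4]
        show ?thesis by blast
      qed
      then obtain W where W: "dangerous W" "{e, f, g} \<subseteq> \<sigma> W" by blast
      then have "\<sigma> W \<subseteq> \<sigma> X" using X(2) by (intro edges_into_mono) simp
      then show ?thesis using W(2) by blast
    qed
    then show ?thesis using maximal(3)[OF independent_edges_into[OF X(1)]] by blast
  qed
  then show ?thesis using that X(1) by blast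
qed

lemma maximal_eq_edges_into:
  assumes "maximal_independent_set L I" "e \<in> I" "f \<in> I" "e \<noteq> f"
  obtains X where "dangerous X" "I = \<sigma> X"
proof -
  have "obstructed e f"
    by (rule obstructed_if_independent[OF maximal_independent_setD(1)]) (rule assms)+
  from maximal_sets_through_pair[OF this assms(4)] show ?thesis using that assms(1-3) by metis
qed

sublocale almost_disjoint_sgraph L
proof
  fix I J assume IJ: "maximal_independent_set L I" "maximal_independent_set L J" "I \<noteq> J"
  have "e = f" if ef: "e \<in> I \<inter> J" "f \<in> I \<inter> J" for e f
  proof (rule ccontr)
    assume "e \<noteq> f"
    then have "obstructed e f"
      using obstructed_if_independent[OF maximal_independent_setD(1)[OF IJ(1)]] ef by simp
    from maximal_sets_through_pair[OF this \<open>e \<noteq> f\<close>] show False using IJ ef by (metis IntD1 IntD2)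
  qed
  then show "card (I \<inter> J) \<le> 1"
    using finite_maximal[OF IJ(1)] by (simp add: card_le_Suc0_iff_eq)
qed

lemma card_independent_bound:
  assumes "independent_set L I"
  shows "2 * card I \<le> D + 1"
proof -
  obtain J where J: "maximal_independent_set L J" "I \<subseteq> J"
    using independent_set_extends_to_maximal[OF assms] .
  have "2 * card J \<le> D + 1"
  proof (cases "\<exists>e \<in> J. \<exists>f \<in> J. e \<noteq> f")
    case True
    then show ?thesis using maximal_eq_edges_into[OF J(1)] card_edges_into_dangerous by metis
  next
    case False
    then have "card J \<le> Suc 0" using finite_maximal[OF J(1)] by (auto simp: card_le_Suc0_iff_eq)
    then show ?thesis using degree_ge_4 by linarith
  qed
  then show ?thesis using card_mono[OF finite_maximal[OF J(1)] J(2)] by linarith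
qed

lemma card_vertices: "card (fst L) = D"
  by (simp add: fst_lifting_graph degree_def)

lemma not_star: "\<not> star L"
proof
  assume "star L"
  then obtain I where "independent_set L I" "card (fst L) = Suc (card I)"
    by (rule star_has_large_independent_set)
  then show False using card_independent_bound[of I] card_vertices degree_ge_4 by simp
qed

lemma complete_multipartite_if_disjoint:
  assumes "\<And>I J. maximal_independent_set L I \<Longrightarrow> maximal_independent_set L J \<Longrightarrow> I \<noteq> J \<Longrightarrow> I \<inter> J = {}"
  shows "complete_multipartite L"
  using assms card_vertices degree_ge_4 by (intro complete_multipartite_if_maximal_disjoint) auto

context
  fixes I J
  assumes I: "maximal_independent_set L I" and J: "maximal_independent_set L J"
    and distinct: "I \<noteq> J" and intersecting: "I \<inter> J \<noteq> {}"
begin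

lemma intersecting_maximal_crossing:
  obtains X Y where "crossing X Y" "I = \<sigma> X" "J = \<sigma> Y"
proof -
  obtain z where z: "z \<in> I" "z \<in> J" using intersecting by auto
  have "\<not> I \<subseteq> J" "\<not> J \<subseteq> I"
    using maximal_independent_setD(1,3)[OF I] maximal_independent_setD(1,3)[OF J] distinct by blast+
  then obtain a b where ab: "a \<in> I" "a \<notin> J" "b \<in> J" "b \<notin> I" by auto
  obtain X where X: "dangerous X" "I = \<sigma> X" using maximal_eq_edges_into[OF I z(1) ab(1)] z ab by metis
  obtain Y where Y: "dangerous Y" "J = \<sigma> Y" using maximal_eq_edges_into[OF J z(2) ab(3)] z ab by metis
  have "X - Y \<noteq> {}" "Y - X \<noteq> {}" using ab X Y by (auto simp: edges_into_def)
  then show ?thesis using that X Y intersecting by (simp add: crossing_def)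
qed

lemma intersecting_maximal_card:
  obtains (covering) "odd D" "2 * card I = D + 1" "2 * card J = D + 1"
  | (noncovering) "odd k" "2 * card (I \<union> J) \<le> D + 2"
proof -
  obtain X Y where XY: "crossing X Y" and IJ: "I = \<sigma> X" "J = \<sigma> Y"
    by (rule intersecting_maximal_crossing)
  show ?thesis
  proof (cases "X \<union> Y = U")
    case True
    then have "Y \<union> X = U" by auto
    then have "2 * card I = D + 1" "2 * card J = D + 1"
      using crossing_covering[OF XY True] crossing_covering[OF crossing_sym[OF XY]] IJ by simp_all
    moreover from this have "odd D" by presburger
    ultimately show ?thesis by (intro covering)
  next
    case False
    note union = crossing_union[OF XY False]
    have "\<not> dangerous (X \<union> Y)"
    proof
      assume "dangerous (X \<union> Y)"
      then have "independent_set L (I \<union> J)"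
        using independent_edges_into[of "X \<union> Y"] IJ by (simp add: edges_into_Un)
      then have "I \<union> J = I" "I \<union> J = J"
        using maximal_independent_setD(3)[OF I] maximal_independent_setD(3)[OF J] by simp_all
      then show False using distinct by simp
    qed
    moreover have "2 * card (\<sigma> (X \<union> Y)) + k \<le> d (X \<union> Y) + D"
      using XY union(1) by (intro card_edges_into_bound) (auto simp: crossing_def dangerous_def)
    ultimately have "odd k" "2 * card (I \<union> J) \<le> D + 2"
      using union(2,3) IJ by (auto simp: edges_into_Un)
    then show ?thesis by (rule noncovering)
  qed
qed

lemma covering_pair_card:
  assumes "I \<union> J = fst L"
  shows "odd D \<and> card I = (D + 1) div 2 \<and> card J = (D + 1) div 2"
  using intersecting_maximal_card
proof cases
  case covering
  then show ?thesis by presburger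
next
  case noncovering
  then show ?thesis using assms card_vertices degree_ge_4 by simp
qed

lemma half_degree_pair_covers:
  assumes "D > 4" and half: "card I = (D + 1) div 2" "card J = (D + 1) div 2"
  shows "I \<union> J = fst L"
proof (rule card_seteq[OF finite_vertices])
  show "I \<union> J \<subseteq> fst L" using maximal_independent_setD(2) I J by blast
  have sum: "card I + card J = Suc (card (I \<union> J))"
    by (rule card_maximal_Un[OF I J distinct intersecting])
  show "card (fst L) \<le> card (I \<union> J)"
    using intersecting_maximal_card
  proof cases
    case covering
    then show ?thesis using sum card_vertices by simp
  next
    case noncovering
    then show ?thesis using sum half \<open>D > 4\<close> by linarith
  qed
qed

lemma half_degree_pair_structure:
  assumes "D > 4" and half: "card I = (D + 1) div 2" "card J = (D + 1) div 2"
  shows "\<exists>z H. isolated_vertex_plus L z H \<and> balanced_complete_bipartite H \<and>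
    {K. maximal_independent_set L K} = {I, J} \<and> I \<inter> J = {z}"
  using half_degree_pair_covers[OF assms] half
  by (intro covering_pair_structure[OF I J distinct intersecting]) simp_all

end

lemma maximal_disjoint_if_even:
  assumes "even k"
    and few: "even D \<or> (\<forall>I J. independent_set L I \<and> card I = (D + 1) div 2 \<and>
      independent_set L J \<and> card J = (D + 1) div 2 \<longrightarrow> I = J)"
    and I: "maximal_independent_set L I" and J: "maximal_independent_set L J" and "I \<noteq> J"
  shows "I \<inter> J = {}"
proof (rule ccontr)
  assume "I \<inter> J \<noteq> {}"
  with I J \<open>I \<noteq> J\<close> show False
  proof (cases rule: intersecting_maximal_card)
    case covering
    then have "card I = (D + 1) div 2" "card J = (D + 1) div 2" by presburger+
    then show False
      using few covering(1) maximal_independent_setD(1)[OF I] maximal_independent_setD(1)[OF J]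
        \<open>I \<noteq> J\<close> by blast
  qed (use \<open>even k\<close> in simp)
qed

end

lemma int_eq_ceiling_half_iff: "int n = \<lceil>real m / 2\<rceil> \<longleftrightarrow> n = (m + 1) div 2"
proof -
  have "\<lceil>real m / 2\<rceil> = int ((m + 1) div 2)"
    by (cases "even m") (auto elim!: evenE oddE simp: ceiling_eq_iff)
  then show ?thesis by linarith
qed

theorem theorem3p5:
  fixes G :: "('v, 'e) multigraph" and s :: 'v and k :: nat
    and d :: nat and L :: "'e sgraph"
  defines "d \<equiv> degree G s" and "L \<equiv> lifting_graph G s k"
  assumes "sk_edge_connected G s k" and "k \<ge> 2" and "d \<ge> 4"
  shows
    "(\<forall>I J. maximal_independent_set L I \<and> maximal_independent_set L J \<and> I \<noteq> J
        \<longrightarrow> card (I \<inter> J) \<le> 1) \<and>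
     (\<forall>I J. maximal_independent_set L I \<and> maximal_independent_set L J \<and> I \<noteq> J \<and>
        I \<inter> J \<noteq> {} \<and> I \<union> J = fst L
        \<longrightarrow> odd d \<and> card I = (d + 1) div 2 \<and> card J = (d + 1) div 2) \<and>
     (d > 4 \<longrightarrow>
       (\<forall>I J. maximal_independent_set L I \<and> maximal_independent_set L J \<and> I \<noteq> J \<and>
          I \<inter> J \<noteq> {} \<and> int (card I) = \<lceil>real d / 2\<rceil> \<and> int (card J) = \<lceil>real d / 2\<rceil>
          \<longrightarrow> (\<exists>z H. isolated_vertex_plus L z H \<and> balanced_complete_bipartite H \<and>
                 {K. maximal_independent_set L K} = {I, J} \<and> I \<inter> J = {z}))) \<and>
     (even k \<and>
      (even d \<or>
       (\<forall>I J. independent_set L I \<and> int (card I) = \<lceil>real d / 2\<rceil> \<and>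
              independent_set L J \<and> int (card J) = \<lceil>real d / 2\<rceil> \<longrightarrow> I = J))
      \<longrightarrow> (\<forall>I J. maximal_independent_set L I \<and> maximal_independent_set L J \<and> I \<noteq> J
              \<longrightarrow> I \<inter> J = {}) \<and>
          complete_multipartite L) \<and>
     (complete_multipartite L \<longrightarrow> \<not> star L)"
proof -
  interpret sk_lifting_graph G s k
    using assms by unfold_locales (simp_all add: d_def)
  show ?thesis
    unfolding d_def L_def int_eq_ceiling_half_iff
  proof (intro conjI, goal_cases pairwise covering half_degree even star)
    case pairwise
    show ?case using card_maximal_Int_le_1 by blast
  next
    case covering
    show ?case using covering_pair_card by blast
  next
    case half_degree
    show ?case using half_degree_pair_structure by blast
  next
    case even
    show ?case using maximal_disjoint_if_even complete_multipartite_if_disjoint by meson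
  next
    case star
    show ?case using not_star by blast
  qed
qed

end
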